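(* The automorphism groups of rank two Lie conformal algebras are as follows. (1) $\mathrm{Aut}\,R_c\cong GL(2,\mathbb{C}[\partial])$, $\mathrm{Aut}\,R_{ss}\cong\mathbb{Z}_2$ and $\mathrm{Aut}\,R_{cs}\cong\mathbb{C}^\times$. (2) For every non-zero skew-symmetric polynomial $Q(\lambda,\partial)$, $\mathrm{Aut}\,R_{nil}(Q(\lambda,\partial))\cong\mathbb{C}^\times\ltimes\mathbb{C}[\partial]$. (3) For every non-zero polynomial $a(\lambda)$, $\mathrm{Aut}\,R_{sol}(a(\lambda))\cong\mathbb{C}^\times\ltimes\mathbb{C}$. (4) For the algebras $R(c,d,Q_c(\lambda,\partial))$, $$\mathrm{Aut}\,R(c,d,Q_c(\lambda,\partial))\cong\begin{cases}\mathbb{C}^\times\ltimes\mathbb{C}&\text{if }d\neq0,\\ \mathbb{C}&\text{if }d=0,\ c\notin\{1,0,-1\},\ Q_c(\lambda,\partial)\neq0,\\ \mathbb{C}^\times\ltimes\mathbb{C}&\text{if }d=0,\ c\notin\{1,0,-1\},\ Q_c(\lambda,\partial)=0,\\ \mathbb{C}^2&\text{if }d=0,\ c\in\{1,0,-1\},\ Q_c(\lambda,\partial)\neq0,\\ \mathbb{C}^\times\ltimes\mathbb{C}^2&\text{if }d=0,\ c\in\{1,0,-1\},\ Q_c(\lambda,\partial)=0.\end{cases}$$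
   Context: All vector spaces are over $\mathbb{C}$. A Lie conformal algebra is a $\mathbb{C}[\partial]$-module $R$ with a $\mathbb{C}$-linear map $R\otimes R\to\mathbb{C}[\lambda]\otimes R$, $a\otimes b\mapsto[a_\lambda b]$, such that for all $a,b,c\in R$: $[\partial a_\lambda b]=-\lambda[a_\lambda b]$ and $[a_\lambda\partial b]=(\lambda+\partial)[a_\lambda b]$; $[b_\lambda a]=-[a_{-\lambda-\partial}b]$; $[a_\lambda[b_\mu c]]-[b_\mu[a_\lambda c]]=[[a_\lambda b]_{\lambda+\mu}c]$. It has rank two if it is free of rank two as a $\mathbb{C}[\partial]$-module; a basis means a $\mathbb{C}[\partial]$-basis. An automorphism is a bijective $\mathbb{C}[\partial]$-module map preserving $\lambda$-brackets; $\mathrm{Aut}\,R$ is the group of automorphisms of $R$. A polynomial $f(x,y)\in\mathbb{C}[x,y]$ is skew-symmetric if $f(x,y)=-f(-x-y,y)$. The rank two Lie conformal algebras in question are: - $R_c$: the commutative one (all $\lambda$-brackets zero). - $R_{ss}$: the semisimple one, with basis $\{L^1,L^2\}$, $[L^i{}_\lambda L^j]=\delta_{i,j}(2\lambda+\partial)L^i$. - $R_{cs}$: basis $\{K,L\}$ with $[K_\lambda K]=[K_\lambda L]=0$, $[L_\lambda L]=(2\lambda+\partial)L$. - $R_{nil}(Q(\lambda,\partial))$: basis $\{A,B\}$ with $[A_\lambda A]=[B_\lambda A]=0$, $[B_\lambda B]=Q(\lambda,\partial)A$, $Q$ skew-symmetric. - $R_{sol}(a(\lambda))$, $a(\lambda)\in\mathbb{C}[\lambda]$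 non-zero: basis $\{A,B\}$ with $[A_\lambda A]=[B_\lambda B]=0$, $[B_\lambda A]=a(\lambda)A$. - $R(c,d,Q_c(\lambda,\partial))$, $c,d\in\mathbb{C}$: basis $\{A,B\}$ with $[A_\lambda A]=0$, $[B_\lambda A]=(c\lambda+d+\partial)A$, $[B_\lambda B]=Q_c(\lambda,\partial)A+(2\lambda+\partial)B$, where $Q_c=0$ unless $d=0$ and $c\in\{1,0,-1,-4,-6\}$, and in those cases $Q_c$ is of the following form with $\beta,\gamma\in\mathbb{C}$ (possibly zero): for $c=1$, $\beta(2\lambda+\partial)$; for $c=0$, $\beta(2\lambda+\partial)(\lambda^2+\lambda\partial)+\gamma(2\lambda+\partial)\partial$; for $c=-1$, $\beta(2\lambda+\partial)\partial^2+\gamma(2\lambda+\partial)(\lambda^2+\lambda\partial)\partial$; for $c=-4$, $\beta(2\lambda+\partial)(\lambda^2+\lambda\partial)^3$; for $c=-6$, $\beta(2\lambda+\partial)[11(\lambda^2+\lambda\partial)^4+2(\lambda^2+\lambda\partial)^3\partial^2]$. In the groups above, $\mathbb{C}$, $\mathbb{C}^2$ and $\mathbb{C}[\partial]$ denote additive groups, and $\mathbb{C}^\times\ltimes V$ is the semidirect product in which $\mathbb{C}^\times$ acts on the vector space $V$ by scalar multiplication.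
   Formalization: In the definition of R_nil(Q), the misprinted relation [B_λ B]=0, which contradicts [B_λ B]=Q(λ,∂)A for non-zero Q, is read as [B_λ A]=0. *)

theory Defs
  imports
    "HOL-Algebra.Elementary_Groups"
    "HOL-Analysis.Determinants"
    "HOL-Computational_Algebra.Polynomial"
begin

section \<open>Lie conformal algebras\<close>

text \<open>
  A $\mathbb{C}[\partial]$-module is a module over \<^typ>\<open>complex poly\<close>, whose
  indeterminate acts as $\partial$.  The space $\mathbb{C}[\lambda]\otimes R$ is
  \<^typ>\<open>'r poly\<close>, the polynomials in $\lambda$ with coefficients in $R$.

  The value of \<open>subst_lambda T \<iota> p\<close> at $p = \sum_n \lambda^n x_n$ is
  $\sum_n T^n(\iota(x_n))$: the operator $T$ is substituted for $\lambda$.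
\<close>

definition subst_lambda ::
    "('m \<Rightarrow> 'm) \<Rightarrow> ('r \<Rightarrow> 'm) \<Rightarrow> 'r::zero poly \<Rightarrow> 'm::comm_monoid_add" where
  "subst_lambda T \<iota> p = (\<Sum>n\<le>degree p. (T ^^ n) (\<iota> (coeff p n)))"

text \<open>
  In \<^typ>\<open>'r poly poly\<close> $= \mathbb{C}[\lambda,\mu]\otimes R$ the outer
  indeterminate is $\mu$ and the inner one is $\lambda$.
\<close>

definition mult_lambda :: "'r::comm_monoid_add poly poly \<Rightarrow> 'r poly poly" where
  "mult_lambda = map_poly (pCons 0)"

definition mult_mu :: "'r::comm_monoid_add poly poly \<Rightarrow> 'r poly poly" where
  "mult_mu = pCons 0"

definition const2 :: "'r::comm_monoid_add \<Rightarrow> 'r poly poly" where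
  "const2 x = [:[:x:]:]"

locale lie_conformal_algebra = Modules.module smul
  for smul :: "complex poly \<Rightarrow> 'r::ab_group_add \<Rightarrow> 'r" (infixr \<open>*s\<close> 75) +
  fixes bracket :: "'r \<Rightarrow> 'r \<Rightarrow> 'r poly"
  assumes bracket_add_left: "bracket (a + a') b = bracket a b + bracket a' b"
    and bracket_add_right: "bracket a (b + b') = bracket a b + bracket a b'"
    and bracket_const_left: "bracket ([:k:] *s a) b = map_poly (\<lambda>x. [:k:] *s x) (bracket a b)"
    and bracket_const_right: "bracket a ([:k:] *s b) = map_poly (\<lambda>x. [:k:] *s x) (bracket a b)"
    and sesquilinear_left: "bracket ([:0, 1:] *s a) b = - pCons 0 (bracket a b)"
    and sesquilinear_right:
      "bracket a ([:0, 1:] *s b)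
        = pCons 0 (bracket a b) + map_poly (\<lambda>x. [:0, 1:] *s x) (bracket a b)"
    and skew_symmetry:
      "bracket b a =
        - subst_lambda (\<lambda>p. - pCons 0 p - map_poly (\<lambda>x. [:0, 1:] *s x) p)
            (\<lambda>x. [:x:]) (bracket a b)"
    and jacobi:
      "subst_lambda mult_mu (\<lambda>x. subst_lambda mult_lambda const2 (bracket a x)) (bracket b c)
        - subst_lambda mult_lambda (\<lambda>x. subst_lambda mult_mu const2 (bracket b x)) (bracket a c)
        = subst_lambda mult_lambda
            (\<lambda>x. subst_lambda (\<lambda>p. mult_lambda p + mult_mu p) const2 (bracket x c))
            (bracket a b)"

definition Aut ::
    "(complex poly \<Rightarrow> 'r::ab_group_add \<Rightarrow> 'r) \<Rightarrow> ('r \<Rightarrow> 'r \<Rightarrow> 'r poly) \<Rightarrow> ('r \<Rightarrow> 'r) monoid" where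
  "Aut smul bracket =
    \<lparr>carrier = {\<phi>. bij \<phi> \<and> module_hom smul smul \<phi> \<and>
                 (\<forall>a b. map_poly \<phi> (bracket a b) = bracket (\<phi> a) (\<phi> b))},
     monoid.mult = (\<circ>), one = id\<rparr>"


section \<open>Polynomials in \<open>\<lambda>\<close> and \<open>\<partial>\<close>\<close>

text \<open>
  A polynomial $f(\lambda,\partial)$ is an element of $\mathbb{C}[\partial][\lambda]$:
  the outer indeterminate of \<^typ>\<open>complex poly poly\<close> is $\lambda$, the inner one $\partial$.
\<close>

abbreviation lam :: "complex poly poly" where "lam \<equiv> [:0, 1:]"
abbreviation del :: "complex poly poly" where "del \<equiv> [:[:0, 1:]:]"
abbreviation const :: "complex \<Rightarrow> complex poly poly" where "const k \<equiv> [:[:k:]:]"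

definition in_lambda :: "complex poly \<Rightarrow> complex poly poly" where
  "in_lambda a = map_poly (\<lambda>k. [:k:]) a"

text \<open>The element $f(\lambda,\partial)\,x$ of $\mathbb{C}[\lambda]\otimes R$.\<close>

definition act ::
    "(complex poly \<Rightarrow> 'r::ab_group_add \<Rightarrow> 'r) \<Rightarrow> complex poly poly \<Rightarrow> 'r \<Rightarrow> 'r poly" where
  "act smul f x = map_poly (\<lambda>q. smul q x) f"

definition skew_symmetric :: "complex poly poly \<Rightarrow> bool" where
  "skew_symmetric f \<longleftrightarrow> f = - pcompose f (- lam - del)"

definition admissible_Q :: "complex \<Rightarrow> complex \<Rightarrow> complex poly poly \<Rightarrow> bool" where
  "admissible_Q c d Q \<longleftrightarrow>
    (\<not> (d = 0 \<and> c \<in> {1, 0, -1, -4, -6}) \<longrightarrow> Q = 0) \<and>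
    (d = 0 \<and> c = 1 \<longrightarrow> (\<exists>\<beta>. Q = const \<beta> * (2 * lam + del))) \<and>
    (d = 0 \<and> c = 0 \<longrightarrow> (\<exists>\<beta> \<gamma>.
       Q = const \<beta> * (2 * lam + del) * (lam ^ 2 + lam * del)
           + const \<gamma> * (2 * lam + del) * del)) \<and>
    (d = 0 \<and> c = -1 \<longrightarrow> (\<exists>\<beta> \<gamma>.
       Q = const \<beta> * (2 * lam + del) * del ^ 2
           + const \<gamma> * (2 * lam + del) * (lam ^ 2 + lam * del) * del)) \<and>
    (d = 0 \<and> c = -4 \<longrightarrow> (\<exists>\<beta>.
       Q = const \<beta> * (2 * lam + del) * (lam ^ 2 + lam * del) ^ 3)) \<and>
    (d = 0 \<and> c = -6 \<longrightarrow> (\<exists>\<beta>.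
       Q = const \<beta> * (2 * lam + del)
           * (11 * (lam ^ 2 + lam * del) ^ 4 + 2 * (lam ^ 2 + lam * del) ^ 3 * del ^ 2)))"


section \<open>The rank two Lie conformal algebras\<close>

definition is_basis2 ::
    "(complex poly \<Rightarrow> 'r::ab_group_add \<Rightarrow> 'r) \<Rightarrow> 'r \<Rightarrow> 'r \<Rightarrow> bool" where
  "is_basis2 smul A B \<longleftrightarrow>
    A \<noteq> B \<and> \<not> module.dependent smul {A, B} \<and> module.span smul {A, B} = UNIV"

text \<open>
  Each predicate below says that \<open>(smul, bracket)\<close> is, up to isomorphism, the algebra
  in its name.  Brackets of basis elements which are not listed are determined by
  skew-symmetry.
\<close>

definition is_R_c where
  "is_R_c smul bracket \<longleftrightarrow> lie_conformal_algebra smul bracket \<and>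
    (\<exists>A B. is_basis2 smul A B) \<and> (\<forall>a b. bracket a b = 0)"

definition is_R_ss where
  "is_R_ss smul bracket \<longleftrightarrow> lie_conformal_algebra smul bracket \<and>
    (\<exists>L1 L2. is_basis2 smul L1 L2 \<and>
       bracket L1 L1 = act smul (2 * lam + del) L1 \<and> bracket L1 L2 = 0 \<and>
       bracket L2 L1 = 0 \<and> bracket L2 L2 = act smul (2 * lam + del) L2)"

definition is_R_cs where
  "is_R_cs smul bracket \<longleftrightarrow> lie_conformal_algebra smul bracket \<and>
    (\<exists>K L. is_basis2 smul K L \<and>
       bracket K K = 0 \<and> bracket K L = 0 \<and> bracket L L = act smul (2 * lam + del) L)"

definition is_R_nil where
  "is_R_nil Q smul bracket \<longleftrightarrow> lie_conformal_algebra smul bracket \<and>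
    (\<exists>A B. is_basis2 smul A B \<and>
       bracket A A = 0 \<and> bracket B A = 0 \<and> bracket B B = act smul Q A)"

definition is_R_sol where
  "is_R_sol a smul bracket \<longleftrightarrow> lie_conformal_algebra smul bracket \<and>
    (\<exists>A B. is_basis2 smul A B \<and>
       bracket A A = 0 \<and> bracket B B = 0 \<and> bracket B A = act smul (in_lambda a) A)"

definition is_R where
  "is_R c d Q smul bracket \<longleftrightarrow> lie_conformal_algebra smul bracket \<and>
    (\<exists>A B. is_basis2 smul A B \<and>
       bracket A A = 0 \<and>
       bracket B A = act smul (const c * lam + const d + del) A \<and>
       bracket B B = act smul Q A + act smul (2 * lam + del) B)"


section \<open>The groups\<close>

definition GL2 :: "((complex poly) ^ 2 ^ 2) monoid" where
  "GL2 = \<lparr>carrier = {M. invertible M}, monoid.mult = (**), one = mat 1\<rparr>"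

definition C_units :: "complex monoid" where
  "C_units = \<lparr>carrier = UNIV - {0}, monoid.mult = (*), one = 1\<rparr>"

definition additive_group :: "'v::ab_group_add monoid" where
  "additive_group = \<lparr>carrier = UNIV, monoid.mult = (+), one = 0\<rparr>"

definition semidirect_product ::
    "('h, 'x) monoid_scheme \<Rightarrow> ('n, 'y) monoid_scheme \<Rightarrow> ('h \<Rightarrow> 'n \<Rightarrow> 'n) \<Rightarrow> ('h \<times> 'n) monoid" where
  "semidirect_product H N \<theta> =
    \<lparr>carrier = carrier H \<times> carrier N,
     monoid.mult = (\<lambda>(h, n) (h', n'). (h \<otimes>\<^bsub>H\<^esub> h', n \<otimes>\<^bsub>N\<^esub> \<theta> h n')),
     one = (\<one>\<^bsub>H\<^esub>, \<one>\<^bsub>N\<^esub>)\<rparr>"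

text \<open>The group $\mathbb{C}^\times\ltimes V$, for $V$ with scalar multiplication \<open>sc\<close>.\<close>

definition C_units_semidirect ::
    "(complex \<Rightarrow> 'v \<Rightarrow> 'v) \<Rightarrow> (complex \<times> 'v::ab_group_add) monoid" where
  "C_units_semidirect sc = semidirect_product C_units additive_group sc"

lemma group_C_units: "group C_units"
  by (rule groupI) (auto simp: C_units_def intro: exI[of _ "inverse _"] left_inverse)

lemma group_additive_group: "group (additive_group :: 'v::ab_group_add monoid)"
  by (rule groupI) (auto simp: additive_group_def add.assoc intro: exI[of _ "- _"])

lemma group_GL2: "group GL2"
proof (rule groupI)
  fix M assume "M \<in> carrier GL2"
  then show "\<exists>N\<in>carrier GL2. N \<otimes>\<^bsub>GL2\<^esub> M = \<one>\<^bsub>GL2\<^esub>"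
    unfolding GL2_def invertible_def by auto
next
  fix M N assume "M \<in> carrier GL2" "N \<in> carrier GL2"
  then show "M \<otimes>\<^bsub>GL2\<^esub> N \<in> carrier GL2"
    by (simp add: GL2_def invertible_mult)
qed (auto simp: GL2_def matrix_mul_assoc invertible_def intro: exI[of _ "mat 1"])

lemma group_C_units_semidirect:
  assumes "\<And>k x y. sc k (x + y) = sc k x + sc k (y::'v::ab_group_add)"
    and "\<And>k l x. sc (k * l) x = sc k (sc l x)" and "\<And>x. sc 1 x = x"
  shows "group (C_units_semidirect sc)"
proof (rule groupI)
  fix g assume "g \<in> carrier (C_units_semidirect sc)"
  then obtain k v where g: "g = (k, v)" "k \<noteq> 0"
    by (auto simp: C_units_semidirect_def semidirect_product_def C_units_def additive_group_def)
  show "\<exists>h\<in>carrier (C_units_semidirect sc).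
      h \<otimes>\<^bsub>C_units_semidirect sc\<^esub> g = \<one>\<^bsub>C_units_semidirect sc\<^esub>"
    by (rule bexI[of _ "(inverse k, - sc (inverse k) v)"])
      (use g in \<open>auto simp: C_units_semidirect_def semidirect_product_def C_units_def additive_group_def\<close>)
qed (auto simp: C_units_semidirect_def semidirect_product_def C_units_def additive_group_def
      assms algebra_simps)

lemma group_Aut:
  assumes "lie_conformal_algebra smul bracket"
  shows "group (Aut smul bracket)"
proof -
  interpret lie_conformal_algebra smul bracket by fact
  show ?thesis
  proof (rule groupI)
    fix \<phi> \<psi> assume *: "\<phi> \<in> carrier (Aut smul bracket)" "\<psi> \<in> carrier (Aut smul bracket)"
    have [simp]: "\<phi> 0 = 0" "\<psi> 0 = 0"
      using * by (auto simp: Aut_def module_hom.zero)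
    have "map_poly (\<phi> \<circ> \<psi>) p = map_poly \<phi> (map_poly \<psi> p)" for p
      by (simp add: poly_eq_iff coeff_map_poly)
    then show "\<phi> \<otimes>\<^bsub>Aut smul bracket\<^esub> \<psi> \<in> carrier (Aut smul bracket)"
      using * by (auto simp: Aut_def intro: bij_comp module_hom_compose)
  next
    show "\<one>\<^bsub>Aut smul bracket\<^esub> \<in> carrier (Aut smul bracket)"
      using module_hom_ident bij_id by (simp add: Aut_def map_poly_id[unfolded id_def] id_def)
  next
    fix \<phi> assume "\<phi> \<in> carrier (Aut smul bracket)"
    then have b: "bij \<phi>" and h: "module_hom smul smul \<phi>"
      and p: "\<And>a b. map_poly \<phi> (bracket a b) = bracket (\<phi> a) (\<phi> b)"
      by (auto simp: Aut_def)
    interpret h: module_hom smul smul \<phi> by fact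
    define \<psi> where "\<psi> = inv_into UNIV \<phi>"
    have i: "\<psi> (\<phi> x) = x" "\<phi> (\<psi> x) = x" for x
      using b by (simp_all add: \<psi>_def bij_is_inj bij_is_surj surj_f_inv_f)
    have hi: "module_hom smul smul \<psi>"
      by unfold_locales (metis h.add h.scale i)+
    interpret hi: module_hom smul smul \<psi> by fact
    have "map_poly \<psi> (map_poly \<phi> q) = q" for q
      by (simp add: poly_eq_iff coeff_map_poly h.zero hi.zero i)
    then have "map_poly \<psi> (bracket a b) = bracket (\<psi> a) (\<psi> b)" for a b
      by (metis p i)
    then have "\<psi> \<in> carrier (Aut smul bracket)"
      using b hi by (auto simp: Aut_def \<psi>_def bij_imp_bij_inv)
    moreover have "\<psi> \<circ> \<phi> = id" using i by auto
    ultimately show "\<exists>\<psi>\<in>carrier (Aut smul bracket). \<psi> \<otimes>\<^bsub>Aut smul bracket\<^esub> \<phi> = \<one>\<^bsub>Aut smul bracket\<^esub>"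
      by (auto simp: Aut_def)
  qed (auto simp: Aut_def comp_assoc)
qed

end

theory Submission
  imports Defs
begin

text \<open>
  Fix a basis $A, B$ of the algebra.  A $\mathbb{C}[\partial]$-endomorphism is then a
  $2\times 2$ matrix over $\mathbb{C}[\partial]$, and sesquilinearity expresses every bracket through
  the brackets of $A$ and $B$.  So an automorphism is an invertible matrix which satisfies
  finitely many identities between polynomials in $\lambda$ and $\partial$
  (\<open>endo_in_Aut_iff\<close>, \<open>bracket_comb\<close>).

  For the commutative algebra there are no identities, and all of $GL(2,\mathbb{C}[\partial])$ remains.
  For the semisimple one every matrix entry $p$ satisfies
  $p(-\lambda)\,p(\lambda+\partial)=p(\partial)$, hence is $0$ or $1$, and only the identity and
  the swap remain.

  In all other algebras $\mathbb{C}[\partial]A$ is an abelian ideal, and comparing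
  suitable components of the brackets shows that every automorphism preserves it.
  The matrix is then triangular, so its diagonal entries are units of $\mathbb{C}[\partial]$,
  that is, non-zero constants $k,s$ with $A\mapsto kA$ and $B\mapsto rA+sB$ for a polynomial $r$.
  The brackets leave, up to $s=1$ in the non-nilpotent cases, one equation for $k,s,r$ (\<open>triangular_in_Aut_iff\<close>):

  \<^item> for the algebra with a central and a Virasoro generator it says $r=0$;
  \<^item> in the nilpotent case it says $k=s^2$ and leaves $r$ free;
  \<^item> in the solvable case it says $r(u)\,a(-v)=r(v)\,a(-u)$, so $r$ is a multiple of $a(-\partial)$;
  \<^item> for $R(c,d,Q)$, in the variables $x=\lambda+\partial$ and $y=-\lambda$, it says that
    $(k-1)Q$ is the coboundary of $r$ (\<open>obstruction\<close>).

  In the last case $d\neq 0$ entails $Q=0$, and setting $y=0$ determines $r$ up to a scalar.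
  Let $d=0$.  The coefficient of $y^2$ in the coboundary of $x^n$ is
  $-\frac{1}{2}n(n-3)x^{n-1}$ up to terms of degree at most one in $x$.  The coefficient of
  $y^2$ in an admissible $Q$ has degree at most one as well, so $r$ has degree at most three.
  The coboundary of a cubic is explicit (\<open>obstruction_cubic\<close>): linear polynomials $tx$ are always
  in the kernel, and exactly for $c=1,0,-1$ there is a second kernel element, $1$, $x^2$ or $x^3$.
  The same formula shows that a non-zero admissible $Q$ is never a coboundary
  (\<open>admissible_Q_not_obstruction\<close>), so $k=1$ when $Q\neq 0$.
\<close>

section \<open>Polynomials in two variables as functions\<close>

text \<open>
  Identities in $\mathbb{C}[\partial][\lambda]$ are verified pointwise: then the substitutions
  $\lambda\mapsto-\lambda-\partial$ and $(\lambda,\partial)\mapsto(-y,x+y)$ become substitutions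
  of numbers.
\<close>

definition eval2 :: "complex poly poly \<Rightarrow> complex \<Rightarrow> complex \<Rightarrow> complex" where
  "eval2 F l d = poly (poly F [:l:]) d"

lemma eval2_simps [simp]:
  "eval2 0 l d = 0" "eval2 1 l d = 1"
  "eval2 (pCons q F) l d = poly q d + l * eval2 F l d"
  "eval2 (F + G) l d = eval2 F l d + eval2 G l d"
  "eval2 (F - G) l d = eval2 F l d - eval2 G l d"
  "eval2 (- F) l d = - eval2 F l d"
  "eval2 (F * G) l d = eval2 F l d * eval2 G l d"
  "eval2 (F ^ n) l d = eval2 F l d ^ n"
  "eval2 (numeral m) l d = numeral m"
  "eval2 (smult q F) l d = poly q d * eval2 F l d"
  by (simp_all add: eval2_def)

lemma eval2_eq_iff: "F = G \<longleftrightarrow> (\<forall>l d. eval2 F l d = eval2 G l d)"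
proof
  assume eq: "\<forall>l d. eval2 F l d = eval2 G l d"
  then have "poly F [:l:] = poly G [:l:]" for l
    by (auto simp: eval2_def fun_eq_iff simp flip: poly_eq_poly_eq_iff)
  then have "range (\<lambda>l::complex. [:l:]) \<subseteq> {q. poly (F - G) q = 0}"
    by auto
  moreover have "infinite (range (\<lambda>l::complex. [:l:]))"
    by (simp add: finite_image_iff inj_on_def infinite_UNIV_char_0)
  ultimately have "infinite {q. poly (F - G) q = 0}"
    by (rule infinite_super)
  then have "F - G = 0"
    using poly_roots_finite by blast
  then show "F = G" by simp
qed simp

lemma eval2_pcompose: "eval2 (F \<circ>\<^sub>p z) l d = eval2 F (eval2 z l d) d"
  by (induction F) (simp_all add: pcompose_pCons)

lemma poly_eqI_by_values:
  fixes p q :: "complex poly"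
  assumes "\<And>x. poly p x = poly q x"
  shows "p = q"
  using assms by (simp add: fun_eq_iff flip: poly_eq_poly_eq_iff)

lemma const_poly_eq_1_iff [simp]: "[:s:] = 1 \<longleftrightarrow> s = (1::complex)"
  by (simp add: poly_eq_iff coeff_pCons split: nat.split)

lemma in_lambda_pCons [simp]: "in_lambda 0 = 0" "in_lambda (pCons k p) = pCons [:k:] (in_lambda p)"
  by (simp_all add: in_lambda_def map_poly_pCons)

lemma in_lambda_1 [simp]: "in_lambda 1 = 1"
  by (simp add: one_pCons)

lemma eval2_in_lambda [simp]: "eval2 (in_lambda p) l d = poly p l"
  by (induction p) simp_all

text \<open>
  This form of cancellation arises when both brackets of a pair of basis elements
  carry the same polynomial $F$, once scaled by $k$ and once by $sk$.
\<close>

lemma const_mult_eq_iff: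
  assumes "k \<noteq> 0"
  shows "[:[:k:]:] * F = [:[:s:]:] * [:[:k:]:] * F \<longleftrightarrow> F = 0 \<or> s = (1::complex)"
proof -
  have "[:[:k:]:] * F = [:[:s:]:] * [:[:k:]:] * F \<longleftrightarrow> ([:[:k:]:] - [:[:s:]:] * [:[:k:]:]) * F = 0"
    unfolding left_diff_distrib right_minus_eq ..
  also have "[:[:k:]:] - [:[:s:]:] * [:[:k:]:] = [:[:k * (1 - s):]:]"
    by (simp add: right_diff_distrib mult.commute)
  finally show ?thesis
    unfolding mult_eq_0_iff using assms by auto
qed

text \<open>
  Sesquilinearity reads
  $[p(\partial)a_\lambda\, q(\partial)b] = p(-\lambda)\,q(\lambda+\partial)[a_\lambda b]$;
  the next two polynomials are the factors that appear.
\<close>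

definition lfac :: "complex poly \<Rightarrow> complex poly poly" where
  "lfac p = in_lambda p \<circ>\<^sub>p (- lam)"

definition rfac :: "complex poly \<Rightarrow> complex poly poly" where
  "rfac p = in_lambda p \<circ>\<^sub>p (lam + del)"

lemma eval2_fac [simp]:
  "eval2 (lfac p) l d = poly p (- l)" "eval2 (rfac p) l d = poly p (l + d)"
  by (simp_all add: lfac_def rfac_def eval2_pcompose add.commute)

lemma fac_simps [simp]:
  "lfac 0 = 0" "lfac 1 = 1" "lfac [:k:] = [:[:k:]:]"
  "rfac 0 = 0" "rfac 1 = 1" "rfac [:k:] = [:[:k:]:]"
  by (simp_all add: lfac_def rfac_def pcompose_1)

lemma lfac_eq_0_iff [simp]: "lfac p = 0 \<longleftrightarrow> p = 0"
proof
  assume "lfac p = 0"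
  then have "poly p (- l) = 0" for l
    by (metis eval2_fac(1) eval2_simps(1))
  then show "p = 0"
    by (metis minus_minus poly_all_0_iff_0)
qed simp

lemma rfac_eq_0_iff [simp]: "rfac p = 0 \<longleftrightarrow> p = 0"
proof
  assume "rfac p = 0"
  then have "poly p (l + 0) = 0" for l
    by (metis eval2_fac(2) eval2_simps(1))
  then show "p = 0"
    using poly_all_0_iff_0[of p] by simp
qed simp

lemma virasoro_ne_0 [simp]: "2 * lam + del \<noteq> 0"
  by (simp add: eval2_eq_iff exI[of _ 1])

section \<open>Coordinates\<close>

text \<open>
  Horner's rule; it allows induction over the polynomial in place of sums of iterates.
\<close>

lemma subst_lambda_pCons:
  assumes "T 0 = 0" "\<And>x y. T (x + y) = T x + T y" "\<iota> 0 = 0"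
  shows "subst_lambda T \<iota> (pCons x p) = \<iota> x + T (subst_lambda T \<iota> p)"
proof -
  have T_sum: "T (sum h I) = (\<Sum>i\<in>I. T (h i))" if "finite I" for h and I :: "nat set"
    using that by induction (simp_all add: assms)
  have T0: "(T ^^ n) 0 = 0" for n
    by (induction n) (simp_all add: assms)
  show ?thesis
  proof (cases "p = 0")
    case True
    then show ?thesis by (cases "x = 0") (simp_all add: subst_lambda_def assms)
  next
    case False
    then show ?thesis
      by (simp add: subst_lambda_def sum.atMost_Suc_shift T_sum del: sum.atMost_Suc)
  qed
qed

lemma subst_lambda_0: "\<iota> 0 = 0 \<Longrightarrow> subst_lambda T \<iota> 0 = 0"
  by (simp add: subst_lambda_def)

locale rank_two = lie_conformal_algebra +
  fixes A B
  assumes basis: "is_basis2 smul A B"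
begin

definition comb where "comb p q = smul p A + smul q B"

definition comb_lam where "comb_lam f g = act smul f A + act smul g B"

lemma comb_exhaust: obtains p q where "x = comb p q"
proof -
  have "x \<in> span {A, B}"
    using basis by (simp add: is_basis2_def)
  then obtain p where "x - smul p A \<in> span {B}"
    unfolding span_insert by blast
  then obtain q where "x - smul p A = smul q B"
    unfolding span_singleton by blast
  then have "x = comb p q"
    by (simp add: comb_def algebra_simps)
  then show ?thesis ..
qed

lemma comb_eq_0_iff: "comb p q = 0 \<longleftrightarrow> p = 0 \<and> q = 0"
proof
  assume "comb p q = 0"
  moreover have "A \<noteq> B" "independent {A, B}"
    using basis by (auto simp: is_basis2_def)
  moreover define u where "u = (\<lambda>v. if v = A then p else q)"
  ultimately have "\<forall>v\<in>{A, B}. u v = 0"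
    using independentD[of "{A, B}" "{A, B}" u] by (simp add: comb_def)
  then show "p = 0 \<and> q = 0"
    using \<open>A \<noteq> B\<close> by (auto simp: u_def split: if_splits)
qed (simp add: comb_def)

lemma comb_diff: "comb p q - comb p' q' = comb (p - p') (q - q')"
  by (simp add: comb_def scale_left_diff_distrib)

lemma comb_eq_iff [simp]: "comb p q = comb p' q' \<longleftrightarrow> p = p' \<and> q = q'"
  using comb_eq_0_iff[of "p - p'" "q - q'"] by (auto simp flip: comb_diff)

lemma comb_add: "comb p q + comb p' q' = comb (p + p') (q + q')"
  by (simp add: comb_def scale_left_distrib)

lemma smul_comb: "smul r (comb p q) = comb (r * p) (r * q)"
  by (simp add: comb_def scale_right_distrib)

lemma comb_basis: "comb 1 0 = A" "comb 0 1 = B"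
  by (simp_all add: comb_def)

lemma coeff_comb_lam: "coeff (comb_lam f g) n = comb (coeff f n) (coeff g n)"
  by (simp add: comb_lam_def act_def comb_def coeff_map_poly)

lemma comb_lam_eq_iff [simp]: "comb_lam f g = comb_lam f' g' \<longleftrightarrow> f = f' \<and> g = g'"
  by (auto simp: poly_eq_iff coeff_comb_lam)

lemma comb_lam_0 [simp]: "comb_lam 0 0 = 0"
  by (simp add: comb_lam_def act_def)

lemma act_basis: "act smul f A = comb_lam f 0" "act smul f B = comb_lam 0 f"
  by (simp_all add: comb_lam_def act_def)

lemma comb_lam_add: "comb_lam f g + comb_lam f' g' = comb_lam (f + f') (g + g')"
  by (simp add: poly_eq_iff coeff_comb_lam comb_add)

lemma comb_lam_minus: "- comb_lam f g = comb_lam (- f) (- g)"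
  using comb_diff[of 0 0] by (simp add: poly_eq_iff coeff_comb_lam comb_eq_0_iff)
    (metis comb_diff comb_eq_0_iff diff_0)

lemma comb_lam_pCons: "comb_lam (pCons p f) (pCons q g) = pCons (comb p q) (comb_lam f g)"
  by (simp add: poly_eq_iff coeff_comb_lam coeff_pCons split: nat.split)

lemma lam_comb_lam: "pCons 0 (comb_lam f g) = comb_lam (lam * f) (lam * g)"
  using comb_lam_pCons[of 0 f 0 g] by (simp add: comb_eq_0_iff[THEN iffD2])

lemma smul_comb_lam: "map_poly (smul p) (comb_lam f g) = comb_lam ([:p:] * f) ([:p:] * g)"
  by (simp add: poly_eq_iff coeff_comb_lam coeff_map_poly smul_comb)


section \<open>The bracket in coordinates\<close>

lemma bracket_0 [simp]: "bracket 0 b = 0" "bracket a 0 = 0"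
  using bracket_add_left[of 0 0 b] bracket_add_right[of a 0 0] by simp_all

lemma smul_pCons: "smul (pCons k p) a = smul [:k:] a + smul [:0, 1:] (smul p a)"
proof -
  have "pCons k p = [:k:] + [:0, 1:] * p" by simp
  then show ?thesis
    by (metis scale_left_distrib scale_scale)
qed

lemma bracket_smul_left:
  assumes "bracket a b = comb_lam f g"
  shows "bracket (smul p a) b = comb_lam (lfac p * f) (lfac p * g)"
proof (induction p)
  case (pCons k p)
  have "lfac (pCons k p) = [:[:k:]:] - lam * lfac p"
    by (simp add: lfac_def pcompose_pCons)
  then show ?case
    by (simp add: smul_pCons[of k p] bracket_add_left bracket_const_left sesquilinear_left assms pCons
        smul_comb_lam lam_comb_lam comb_lam_minus comb_lam_add algebra_simps del: mult_pCons_left scale_scale)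
qed simp

lemma bracket_smul_right:
  assumes "bracket a b = comb_lam f g"
  shows "bracket a (smul p b) = comb_lam (rfac p * f) (rfac p * g)"
proof (induction p)
  case (pCons k p)
  have "rfac (pCons k p) = [:[:k:]:] + (lam + del) * rfac p"
    by (simp add: rfac_def pcompose_pCons)
  then show ?case
    by (simp add: smul_pCons[of k p] bracket_add_right bracket_const_right sesquilinear_right assms pCons
        smul_comb_lam lam_comb_lam comb_lam_add algebra_simps del: mult_pCons_left add_pCons scale_scale)
qed simp

lemma bracket_comb:
  assumes "bracket A A = comb_lam f1 g1" "bracket A B = comb_lam f2 g2"
    and "bracket B A = comb_lam f3 g3" "bracket B B = comb_lam f4 g4"
  shows "bracket (comb p q) (comb p' q') = comb_lam
    (lfac p * rfac p' * f1 + lfac p * rfac q' * f2 + lfac q * rfac p' * f3 + lfac q * rfac q' * f4)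
    (lfac p * rfac p' * g1 + lfac p * rfac q' * g2 + lfac q * rfac p' * g3 + lfac q * rfac q' * g4)"
proof -
  note r = assms[THEN bracket_smul_right]
  note lr = r[THEN bracket_smul_left]
  show ?thesis
    by (simp add: comb_def bracket_add_left bracket_add_right lr comb_lam_add algebra_simps)
qed

text \<open>
  Skew-symmetry: substituting $-\lambda-\partial$ for $\lambda$ acts on each coordinate.
\<close>

lemma bracket_skew:
  assumes "bracket a b = comb_lam f g"
  shows "bracket b a = comb_lam (- (f \<circ>\<^sub>p (- lam - del))) (- (g \<circ>\<^sub>p (- lam - del)))"
proof -
  let ?T = "\<lambda>p. - pCons 0 p - map_poly (smul [:0, 1:]) p"
  have T: "?T (comb_lam u v) = comb_lam ((- lam - del) * u) ((- lam - del) * v)" for u v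
    by (simp only: smul_comb_lam lam_comb_lam comb_lam_minus comb_lam_add diff_conv_add_uminus
        distrib_right minus_mult_left)
  have "subst_lambda ?T (\<lambda>x. [:x:]) (comb_lam f g)
      = comb_lam (f \<circ>\<^sub>p (- lam - del)) (g \<circ>\<^sub>p (- lam - del))"
  proof (induction f g rule: poly_induct2)
    case (pCons a f b g)
    have "subst_lambda ?T (\<lambda>x. [:x:]) (comb_lam (pCons a f) (pCons b g))
        = [:comb a b:] + ?T (subst_lambda ?T (\<lambda>x. [:x:]) (comb_lam f g))"
      unfolding comb_lam_pCons
      by (rule subst_lambda_pCons)
        (simp_all add: poly_eq_iff coeff_map_poly coeff_pCons scale_right_distrib split: nat.split)
    also have "[:comb a b:] = comb_lam [:a:] [:b:]"
      by (simp add: comb_lam_pCons)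
    finally show ?case
      by (simp only: pCons T comb_lam_add pcompose_pCons)
  qed (simp add: subst_lambda_0)
  then show ?thesis
    by (simp add: skew_symmetry[of b a] assms comb_lam_minus)
qed


section \<open>Endomorphisms as matrices\<close>

text \<open>
  The matrix with rows $(a,b)$ and $(c,d)$ acts on columns of coordinates, so that composition
  is the matrix product.
\<close>

definition endo where
  "endo a b c d x = (THE y. \<exists>p q. x = comb p q \<and> y = comb (a * p + b * q) (c * p + d * q))"

lemma endo_comb [simp]: "endo a b c d (comb p q) = comb (a * p + b * q) (c * p + d * q)"
  unfolding endo_def by (rule the_equality) auto

lemma endo_basis: "endo a b c d A = comb a c" "endo a b c d B = comb b d"
  using endo_comb[of a b c d 1 0] endo_comb[of a b c d 0 1] by (simp_all add: comb_basis)

lemma endo_id: "endo 1 0 0 1 = id"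
proof
  fix x show "endo 1 0 0 1 x = id x" by (cases x rule: comb_exhaust) simp
qed

lemma endo_comp:
  "endo a b c d \<circ> endo a' b' c' d'
    = endo (a * a' + b * c') (a * b' + b * d') (c * a' + d * c') (c * b' + d * d')"
proof
  fix x
  show "(endo a b c d \<circ> endo a' b' c' d') x
      = endo (a * a' + b * c') (a * b' + b * d') (c * a' + d * c') (c * b' + d * d') x"
    by (cases x rule: comb_exhaust) (simp add: algebra_simps)
qed

lemma endo_eq_iff [simp]:
  "endo a b c d = endo a' b' c' d' \<longleftrightarrow> a = a' \<and> b = b' \<and> c = c' \<and> d = d'"
proof
  assume "endo a b c d = endo a' b' c' d'"
  then have "endo a b c d A = endo a' b' c' d' A" "endo a b c d B = endo a' b' c' d' B"
    by simp_all
  then show "a = a' \<and> b = b' \<and> c = c' \<and> d = d'"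
    by (simp add: endo_basis)
qed simp

lemma module_hom_endo: "module_hom smul smul (endo a b c d)"
proof unfold_locales
  fix x y
  show "endo a b c d (x + y) = endo a b c d x + endo a b c d y"
    by (cases x rule: comb_exhaust, cases y rule: comb_exhaust) (simp add: comb_add algebra_simps)
next
  fix r x
  show "endo a b c d (smul r x) = smul r (endo a b c d x)"
    by (cases x rule: comb_exhaust) (simp add: smul_comb algebra_simps)
qed

lemma module_hom_endoE:
  assumes "module_hom smul smul \<phi>"
  obtains a b c d where "\<phi> = endo a b c d"
proof -
  interpret \<phi>: module_hom smul smul \<phi> by fact
  obtain a c where ac: "\<phi> A = comb a c" by (rule comb_exhaust)
  obtain b d where bd: "\<phi> B = comb b d" by (rule comb_exhaust)
  have "\<phi> x = endo a b c d x" for x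
  proof (cases x rule: comb_exhaust)
    case (1 p q)
    then have "\<phi> x = smul p (\<phi> A) + smul q (\<phi> B)"
      by (simp add: comb_def \<phi>.add \<phi>.scale)
    then show ?thesis
      by (simp add: 1 ac bd smul_comb comb_add mult.commute)
  qed
  then show ?thesis by (blast intro: that)
qed

lemma bij_endo_iff:
  "bij (endo a b c d) \<longleftrightarrow> (\<exists>a' b' c' d'. endo a b c d \<circ> endo a' b' c' d' = id \<and>
     endo a' b' c' d' \<circ> endo a b c d = id)"
proof
  assume bij: "bij (endo a b c d)"
  define \<psi> where "\<psi> = inv_into UNIV (endo a b c d)"
  have inv: "endo a b c d (\<psi> x) = x" "\<psi> (endo a b c d x) = x" for x
    using bij by (simp_all add: \<psi>_def bij_is_inj bij_is_surj surj_f_inv_f)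
  interpret module_hom smul smul "endo a b c d" by (rule module_hom_endo)
  have "module_hom smul smul \<psi>"
    by unfold_locales (metis add scale inv)+
  then obtain a' b' c' d' where "\<psi> = endo a' b' c' d'"
    by (rule module_hom_endoE)
  moreover have "endo a b c d \<circ> \<psi> = id" "\<psi> \<circ> endo a b c d = id"
    using inv by auto
  ultimately show "\<exists>a' b' c' d'. endo a b c d \<circ> endo a' b' c' d' = id \<and>
     endo a' b' c' d' \<circ> endo a b c d = id"
    by blast
next
  assume "\<exists>a' b' c' d'. endo a b c d \<circ> endo a' b' c' d' = id \<and>
     endo a' b' c' d' \<circ> endo a b c d = id"
  then show "bij (endo a b c d)"
    by (auto intro: o_bij)
qed

text \<open>
  If the matrix has an inverse, then the products of the diagonal entries with entries of the inverse
  are $1$, and the units of $\mathbb{C}[\partial]$ are the non-zero constants.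
\<close>

lemma bij_triangular_iff:
  "bij (endo a b 0 d) \<longleftrightarrow> (\<exists>k s. k \<noteq> 0 \<and> s \<noteq> 0 \<and> a = [:k:] \<and> d = [:s:])"
proof
  assume "bij (endo a b 0 d)"
  then obtain a' b' c' d' where
    1: "endo a b 0 d \<circ> endo a' b' c' d' = endo 1 0 0 1" and
    2: "endo a' b' c' d' \<circ> endo a b 0 d = endo 1 0 0 1"
    unfolding bij_endo_iff endo_id by blast
  have "d * d' = 1" "a' * a = 1"
    using 1 2 by (simp_all add: endo_comp)
  then have "a dvd 1" "d dvd 1"
    by (metis dvd_triv_right dvd_triv_left)+
  then show "\<exists>k s. k \<noteq> 0 \<and> s \<noteq> 0 \<and> a = [:k:] \<and> d = [:s:]"
    by (auto simp: is_unit_poly_iff)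
next
  assume "\<exists>k s. k \<noteq> 0 \<and> s \<noteq> 0 \<and> a = [:k:] \<and> d = [:s:]"
  then obtain k s where [simp]: "k \<noteq> 0" "s \<noteq> 0" "a = [:k:]" "d = [:s:]" by blast
  let ?i = "endo [:inverse k:] (- (smult (inverse k * inverse s) b)) 0 [:inverse s:]"
  have "endo a b 0 d \<circ> ?i = endo 1 0 0 1" "?i \<circ> endo a b 0 d = endo 1 0 0 1"
    unfolding endo_comp by (simp_all add: field_simps)
  then show "bij (endo a b 0 d)"
    unfolding bij_endo_iff endo_id by blast
qed

lemma endo_comb_lam:
  "map_poly (endo a b c d) (comb_lam f g)
    = comb_lam ([:a:] * f + [:b:] * g) ([:c:] * f + [:d:] * g)"
  by (simp add: poly_eq_iff coeff_comb_lam coeff_map_poly module_hom.zero[OF module_hom_endo])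

text \<open>
  By sesquilinearity it is enough to check brackets of basis elements.
\<close>

lemma hom_preserves_bracket:
  assumes hom: "module_hom smul smul \<phi>"
    and pres: "\<And>x y. x \<in> {A, B} \<Longrightarrow> y \<in> {A, B} \<Longrightarrow>
      map_poly \<phi> (bracket x y) = bracket (\<phi> x) (\<phi> y)"
  shows "map_poly \<phi> (bracket x y) = bracket (\<phi> x) (\<phi> y)"
proof -
  interpret \<phi>: module_hom smul smul \<phi> by fact
  have map: "map_poly \<phi> (u + v) = map_poly \<phi> u + map_poly \<phi> v"
    "map_poly \<phi> (- u) = - map_poly \<phi> u"
    "map_poly \<phi> (pCons 0 u) = pCons 0 (map_poly \<phi> u)"
    "map_poly \<phi> (map_poly (smul p) u) = map_poly (smul p) (map_poly \<phi> u)" for u v p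
    by (simp_all add: poly_eq_iff coeff_map_poly coeff_pCons \<phi>.add \<phi>.zero \<phi>.neg \<phi>.scale
        split: nat.split)
  have left: "map_poly \<phi> (bracket (smul p x) y) = bracket (\<phi> (smul p x)) (\<phi> y)"
    if "map_poly \<phi> (bracket x y) = bracket (\<phi> x) (\<phi> y)" for p x y
  proof (induction p)
    case (pCons k p)
    then show ?case
      by (simp add: smul_pCons[of k p] \<phi>.add \<phi>.scale bracket_add_left bracket_const_left
          sesquilinear_left map that del: scale_scale)
  qed (simp add: \<phi>.zero)
  have right: "map_poly \<phi> (bracket x (smul p y)) = bracket (\<phi> x) (\<phi> (smul p y))"
    if "map_poly \<phi> (bracket x y) = bracket (\<phi> x) (\<phi> y)" for p x y
  proof (induction p)
    case (pCons k p)
    then show ?case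
      by (simp add: smul_pCons[of k p] \<phi>.add \<phi>.scale bracket_add_right bracket_const_right
          sesquilinear_right map that del: scale_scale)
  qed (simp add: \<phi>.zero)
  have "map_poly \<phi> (bracket x (smul p A + smul q B)) = bracket (\<phi> x) (\<phi> (smul p A + smul q B))"
    if "x \<in> {A, B}" for x p q
    using that by (simp add: bracket_add_right map \<phi>.add right pres)
  then have "map_poly \<phi> (bracket (smul r A + smul s B) (smul p A + smul q B))
      = bracket (\<phi> (smul r A + smul s B)) (\<phi> (smul p A + smul q B))" for r s p q
    unfolding bracket_add_left map \<phi>.add[of "smul r A"] by (intro arg_cong2[of _ _ _ _ "(+)"] left) simp_all
  then show ?thesis
    by (cases x rule: comb_exhaust, cases y rule: comb_exhaust) (simp add: comb_def)
qed

lemma endo_in_Aut_iff: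
  "endo a b c d \<in> carrier (Aut smul bracket) \<longleftrightarrow> bij (endo a b c d) \<and>
    (\<forall>x\<in>{A, B}. \<forall>y\<in>{A, B}. map_poly (endo a b c d) (bracket x y)
      = bracket (endo a b c d x) (endo a b c d y))"
  using hom_preserves_bracket[OF module_hom_endo[of a b c d]] module_hom_endo[of a b c d]
  by (auto simp: Aut_def)

lemma AutE:
  assumes "\<phi> \<in> carrier (Aut smul bracket)"
  obtains a b c d where "\<phi> = endo a b c d"
proof -
  have "module_hom smul smul \<phi>"
    using assms by (simp add: Aut_def)
  then show ?thesis
    by (rule module_hom_endoE) (rule that)
qed

end

section \<open>Describing an automorphism group by parameters\<close>

lemma Aut_iso_of_parametrization:
  assumes "lie_conformal_algebra smul bracket" "group G"
    and "h ` carrier G = carrier (Aut smul bracket)" "inj_on h (carrier G)"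
    and "\<And>x y. x \<in> carrier G \<Longrightarrow> y \<in> carrier G \<Longrightarrow> h (x \<otimes>\<^bsub>G\<^esub> y) = h x \<circ> h y"
  shows "Aut smul bracket \<cong> G"
proof -
  have "h \<in> iso G (Aut smul bracket)"
    using assms(3-5) by (auto simp: iso_def hom_def bij_betw_def, simp add: Aut_def)
  then show ?thesis
    using assms(2) group.iso_sym is_iso_def by blast
qed

context rank_two
begin

text \<open>
  Composing $(A,B)\mapsto(kA,\,B+\rho(v)A)$ after the map with parameters $(k',v')$ sends $B$
  to $B+\rho(v)A+k\rho(v')A$, which is the product in the semidirect product.
\<close>

lemma Aut_iso_C_units_semidirect:
  fixes \<rho> :: "'v::ab_group_add \<Rightarrow> complex poly"
  assumes Aut: "carrier (Aut smul bracket) = {endo [:k:] (\<rho> v) 0 1 | k v. k \<noteq> 0}"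
    and inj: "inj \<rho>" and add: "\<And>u v. \<rho> (u + v) = \<rho> u + \<rho> v"
    and sc: "\<And>k v. \<rho> (sc k v) = smult k (\<rho> v)"
  shows "Aut smul bracket \<cong> C_units_semidirect sc"
proof (rule Aut_iso_of_parametrization)
  show "lie_conformal_algebra smul bracket"
    by (rule lie_conformal_algebra_axioms)
  show "group (C_units_semidirect sc)"
    by (rule group_C_units_semidirect; rule injD[OF inj]; simp add: add sc smult_add_right)
  define h where "h = (\<lambda>(k, v). endo [:k:] (\<rho> v) 0 1)"
  show "h ` carrier (C_units_semidirect sc) = carrier (Aut smul bracket)"
    unfolding Aut
    by (auto simp: C_units_semidirect_def semidirect_product_def C_units_def additive_group_def
        h_def image_iff)
  show "inj_on h (carrier (C_units_semidirect sc))"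
    using injD[OF inj] by (auto simp: inj_on_def h_def)
  show "h (x \<otimes>\<^bsub>C_units_semidirect sc\<^esub> y) = h x \<circ> h y" for x y
    by (cases x, cases y) (simp add: C_units_semidirect_def semidirect_product_def C_units_def
        additive_group_def h_def endo_comp add sc add.commute)
qed

lemma Aut_iso_additive_group:
  fixes \<rho> :: "'v::ab_group_add \<Rightarrow> complex poly"
  assumes Aut: "carrier (Aut smul bracket) = {endo 1 (\<rho> v) 0 1 | v. True}"
    and inj: "inj \<rho>" and add: "\<And>u v. \<rho> (u + v) = \<rho> u + \<rho> v"
  shows "Aut smul bracket \<cong> (additive_group :: 'v monoid)"
proof (rule Aut_iso_of_parametrization)
  show "lie_conformal_algebra smul bracket"
    by (rule lie_conformal_algebra_axioms)
  show "group (additive_group :: 'v monoid)"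
    by (rule group_additive_group)
  define h where "h = (\<lambda>v. endo 1 (\<rho> v) 0 1)"
  show "h ` carrier additive_group = carrier (Aut smul bracket)"
    unfolding Aut by (auto simp: additive_group_def h_def)
  show "inj_on h (carrier additive_group)"
    using injD[OF inj] by (auto simp: inj_on_def h_def)
  show "h (x \<otimes>\<^bsub>additive_group\<^esub> y) = h x \<circ> h y" for x y
    by (simp add: additive_group_def h_def endo_comp add add.commute)
qed

end


section \<open>Algebras with an abelian ideal spanned by a basis element\<close>

text \<open>
  The decomposable, nilpotent and solvable algebras and all $R(c,d,Q)$ are instances; they differ
  in the three structure polynomials only.
\<close>

locale rank_two_ideal = rank_two +
  fixes f Q g
  assumes AA: "bracket A A = 0" and BA: "bracket B A = act smul f A"
    and BB: "bracket B B = act smul Q A + act smul g B"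
begin

lemma AA_comb: "bracket A A = comb_lam 0 0"
  by (simp add: AA)

lemma BA_comb: "bracket B A = comb_lam f 0"
  by (simp add: BA act_basis)

lemma AB_comb: "bracket A B = comb_lam (- (f \<circ>\<^sub>p (- lam - del))) 0"
  using bracket_skew[OF BA_comb] by simp

lemma BB_comb: "bracket B B = comb_lam Q g"
  by (simp add: BB comb_lam_def)

lemma bracket_ideal: "bracket (comb p q) (comb p' q') = comb_lam
    (lfac q * rfac p' * f - lfac p * rfac q' * (f \<circ>\<^sub>p (- lam - del)) + lfac q * rfac q' * Q)
    (lfac q * rfac q' * g)"
  using bracket_comb[of 0 0, OF _ AB_comb BA_comb BB_comb, of p q p' q'] AA by simp

text \<open>
  The components of the brackets from which the invariance of $\mathbb{C}[\partial]A$, that is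
  $c=0$, is read off; which one is conclusive depends on the structure polynomials.
\<close>

lemma Aut_bracket_eqs:
  assumes "endo a b c d \<in> carrier (Aut smul bracket)"
  shows "lfac c * rfac c * g = 0"
    and "lfac c * rfac a * f - lfac a * rfac c * (f \<circ>\<^sub>p (- lam - del)) + lfac c * rfac c * Q = 0"
    and "lfac d * rfac c * g = [:c:] * f"
    and "[:c:] * Q + [:d:] * g = lfac d * rfac d * g"
proof -
  have *: "map_poly (endo a b c d) (bracket x y) = bracket (endo a b c d x) (endo a b c d y)" for x y
    using assms by (simp add: Aut_def)
  show "lfac c * rfac c * g = 0"
    "lfac c * rfac a * f - lfac a * rfac c * (f \<circ>\<^sub>p (- lam - del)) + lfac c * rfac c * Q = 0"
    using *[of A A] unfolding endo_basis bracket_ideal AA_comb endo_comb_lam comb_lam_eq_iff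
    by simp_all
  show "lfac d * rfac c * g = [:c:] * f"
    using *[of B A] unfolding endo_basis bracket_ideal BA_comb endo_comb_lam comb_lam_eq_iff by simp
  show "[:c:] * Q + [:d:] * g = lfac d * rfac d * g"
    using *[of B B] unfolding endo_basis bracket_ideal BB_comb endo_comb_lam comb_lam_eq_iff by simp
qed

text \<open>
  The pairs $(A,A)$, $(A,B)$ and $(B,A)$ only force $s=1$ unless $f=0$; the pair $(B,B)$
  forces $s=1$ unless $g=0$ and contributes the equation.  The argument $-l-d$ of $f$ stems from
  skew-symmetry, by which $[A_\lambda B]$ is given by $-f(-\lambda-\partial,\partial)$.
\<close>

lemma triangular_in_Aut_iff:
  "endo a r 0 b \<in> carrier (Aut smul bracket) \<longleftrightarrow>
    (\<exists>k s. k \<noteq> 0 \<and> s \<noteq> 0 \<and> a = [:k:] \<and> b = [:s:] \<and> (f = 0 \<or> s = 1) \<and> (g = 0 \<or> s = 1) \<and>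
      (\<forall>l d. k * eval2 Q l d + poly r d * eval2 g l d = s * s * eval2 Q l d
        + s * (poly r (l + d) * eval2 f l d - poly r (- l) * eval2 f (- l - d) d)))"
proof -
  define R where "R = (\<lambda>k s. (f = 0 \<or> s = 1) \<and> (g = 0 \<or> s = 1) \<and>
      (\<forall>l d. k * eval2 Q l d + poly r d * eval2 g l d = s * s * eval2 Q l d
        + s * (poly r (l + d) * eval2 f l d - poly r (- l) * eval2 f (- l - d) d)))"
  have R: "endo [:k:] r 0 [:s:] \<in> carrier (Aut smul bracket) \<longleftrightarrow> R k s" if "k \<noteq> 0" "s \<noteq> 0" for k s
  proof -
    let ?f' = "f \<circ>\<^sub>p (- lam - del)"
    let ?P = "\<lambda>x y. map_poly (endo [:k:] r 0 [:s:]) (bracket x y)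
      = bracket (endo [:k:] r 0 [:s:] x) (endo [:k:] r 0 [:s:] y)"
    let ?F = "[:[:k:]:] * Q + [:r:] * g"
    let ?G = "[:[:s:]:] * rfac r * f - lfac r * [:[:s:]:] * ?f' + [:[:s:]:] * [:[:s:]:] * Q"
    have pres_AA: "?P A A"
      unfolding endo_basis bracket_ideal AA_comb endo_comb_lam comb_lam_eq_iff by simp
    have pres_AB: "?P A B" if "f = 0 \<or> s = 1"
      unfolding endo_basis bracket_ideal AB_comb endo_comb_lam comb_lam_eq_iff using that by auto
    have "?P B A \<longleftrightarrow> [:[:k:]:] * f = [:[:s:]:] * [:[:k:]:] * f"
      unfolding endo_basis bracket_ideal BA_comb endo_comb_lam comb_lam_eq_iff by simp
    then have pres_BA: "?P B A \<longleftrightarrow> f = 0 \<or> s = 1"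
      unfolding const_mult_eq_iff[OF that(1)] .
    have "?P B B \<longleftrightarrow> ?F = ?G \<and> [:[:s:]:] * g = [:[:s:]:] * [:[:s:]:] * g"
      unfolding endo_basis bracket_ideal BB_comb endo_comb_lam comb_lam_eq_iff
      by (simp only: fac_simps pCons_0_0 mult_zero_left add_0_left)
    then have pres_BB: "?P B B \<longleftrightarrow> ?F = ?G \<and> (g = 0 \<or> s = 1)"
      unfolding const_mult_eq_iff[OF that(2)] .
    have "eval2 ?G l d = s * s * eval2 Q l d
        + s * (poly r (l + d) * eval2 f l d - poly r (- l) * eval2 f (- l - d) d)" for l d
      by (simp add: eval2_pcompose right_diff_distrib mult.commute
          mult.left_commute minus_diff_commute)
    moreover have "eval2 ?F l d = k * eval2 Q l d + poly r d * eval2 g l d" for l d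
      by simp
    ultimately have "?F = ?G \<longleftrightarrow> (\<forall>l d. k * eval2 Q l d + poly r d * eval2 g l d = s * s * eval2 Q l d
        + s * (poly r (l + d) * eval2 f l d - poly r (- l) * eval2 f (- l - d) d))"
      unfolding eval2_eq_iff by presburger
    then have "(?P A A \<and> ?P A B) \<and> (?P B A \<and> ?P B B) \<longleftrightarrow> R k s"
      unfolding R_def pres_BA pres_BB using pres_AA pres_AB by argo
    moreover have "bij (endo [:k:] r 0 [:s:])"
      using that by (simp add: bij_triangular_iff)
    ultimately show ?thesis
      by (simp only: endo_in_Aut_iff ball_simps simp_thms)
  qed
  have "endo a r 0 b \<in> carrier (Aut smul bracket) \<longleftrightarrow>
      (\<exists>k s. k \<noteq> 0 \<and> s \<noteq> 0 \<and> a = [:k:] \<and> b = [:s:] \<and> R k s)" (is "?L \<longleftrightarrow> ?R")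
  proof
    assume ?L
    then have "bij (endo a r 0 b)"
      by (simp add: endo_in_Aut_iff)
    then show ?R
      using \<open>?L\<close> R unfolding bij_triangular_iff by metis
  next
    assume ?R
    then show ?L
      using R by metis
  qed
  then show ?thesis
    unfolding R_def .
qed

end


section \<open>The commutative and the semisimple algebra\<close>

lemma (in rank_two) Aut_iso_GL2:
  assumes "\<And>a b. bracket a b = 0"
  shows "Aut smul bracket \<cong> GL2"
proof (rule Aut_iso_of_parametrization)
  show "lie_conformal_algebra smul bracket"
    by (rule lie_conformal_algebra_axioms)
  show "group GL2"
    by (rule group_GL2)
  define h where "h = (\<lambda>M :: complex poly ^ 2 ^ 2. endo (M$1$1) (M$1$2) (M$2$1) (M$2$2))"
  have h_eq: "h M = h N \<longleftrightarrow> M = N" for M N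
    by (auto simp: h_def vec_eq_iff forall_2)
  have h_mult: "h (M ** N) = h M \<circ> h N" for M N
    by (simp add: h_def endo_comp matrix_matrix_mult_def sum_2)
  have h_1: "h (mat 1) = id"
    by (simp add: h_def mat_def endo_id)
  have h_surj: "endo a b c d = h (vector [vector [a, b], vector [c, d]])" for a b c d
    by (simp add: h_def)
  have bij_h: "bij (h M) \<longleftrightarrow> invertible M" for M
  proof -
    have "bij (h M) \<longleftrightarrow> (\<exists>a b c d. h M \<circ> endo a b c d = id \<and> endo a b c d \<circ> h M = id)"
      unfolding h_def by (rule bij_endo_iff)
    also have "\<dots> \<longleftrightarrow> (\<exists>N. h M \<circ> h N = id \<and> h N \<circ> h M = id)"
      by (metis h_surj h_def)
    also have "\<dots> \<longleftrightarrow> invertible M"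
      unfolding invertible_def h_mult[symmetric] h_1[symmetric] h_eq by simp
    finally show ?thesis .
  qed
  have h_Aut: "h M \<in> carrier (Aut smul bracket) \<longleftrightarrow> invertible M" for M
    using bij_h[of M] by (simp add: h_def endo_in_Aut_iff assms)
  show "h ` carrier GL2 = carrier (Aut smul bracket)"
  proof (intro equalityI subsetI)
    fix \<phi> assume \<phi>: "\<phi> \<in> carrier (Aut smul bracket)"
    then obtain a b c d where "\<phi> = endo a b c d" by (rule AutE)
    then show "\<phi> \<in> h ` carrier GL2"
      using \<phi> h_Aut unfolding h_surj by (auto simp: GL2_def)
  qed (auto simp: GL2_def h_Aut)
  show "inj_on h (carrier GL2)"
    by (simp add: inj_on_def h_eq)
  show "h (M \<otimes>\<^bsub>GL2\<^esub> N) = h M \<circ> h N" for M N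
    by (simp add: GL2_def h_mult)
qed

text \<open>
  At $\lambda=0$ the identity gives $p=0$ or $p(0)=1$; at $\partial=0$ it gives
  $p(-\lambda)\,p(\lambda)=p(0)$, so that $p\neq 0$ is a unit.
\<close>

lemma bracket_idempotent:
  fixes p :: "complex poly"
  assumes "lfac p * rfac p = [:p:]"
  shows "p = 0 \<or> p = 1"
proof -
  have eq: "poly p (- l) * poly p (l + d) = poly p d" for l d
    using arg_cong[OF assms, of "\<lambda>F. eval2 F l d"] by simp
  show ?thesis
  proof (cases "poly p 0 = 0")
    case True
    then have "poly p d = 0" for d
      using eq[of 0 d] by simp
    then show ?thesis
      using poly_all_0_iff_0[of p] by simp
  next
    case False
    have "[:poly p 0:] = p \<circ>\<^sub>p [:0, - 1:] * p"
      by (rule poly_eqI_by_values) (use eq[of _ 0] in \<open>simp add: poly_pcompose\<close>)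
    then have "p dvd [:poly p 0:]"
      by (metis dvd_triv_right)
    moreover have "[:poly p 0:] dvd 1"
      using False by (simp add: is_unit_const_poly_iff dvd_field_iff)
    ultimately obtain k where "p = [:k:]"
      using dvd_trans is_unit_poly_iff by blast
    then show ?thesis
      using False eq[of 0 0] by simp
  qed
qed

text \<open>
  Both columns of the matrix consist of idempotents $0,1$.  As $[A_\lambda B]=0$, the columns
  have disjoint supports, and injectivity excludes zero columns.
\<close>

lemma (in rank_two) Aut_iso_Z2:
  assumes AA: "bracket A A = act smul (2 * lam + del) A" and AB: "bracket A B = 0"
    and BA: "bracket B A = 0" and BB: "bracket B B = act smul (2 * lam + del) B"
  shows "Aut smul bracket \<cong> integer_mod_group 2"
proof (rule Aut_iso_of_parametrization)
  let ?w = "2 * lam + del"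
  have AA': "bracket A A = comb_lam ?w 0" and AB': "bracket A B = comb_lam 0 0"
    and BA': "bracket B A = comb_lam 0 0" and BB': "bracket B B = comb_lam 0 ?w"
    by (simp_all add: assms act_basis)
  have br: "bracket (comb p q) (comb p' q')
      = comb_lam (lfac p * rfac p' * ?w) (lfac q * rfac q' * ?w)" for p q p' q'
    using bracket_comb[OF AA' AB' BA' BB'] by simp
  have Aut: "carrier (Aut smul bracket) = {endo 1 0 0 1, endo 0 1 1 0}"
  proof (intro equalityI subsetI)
    fix \<phi> assume \<phi>: "\<phi> \<in> carrier (Aut smul bracket)"
    then obtain a b c d where \<phi>_eq: "\<phi> = endo a b c d" by (rule AutE)
    have *: "map_poly (endo a b c d) (bracket x y) = bracket (endo a b c d x) (endo a b c d y)" for x y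
      using \<phi> by (simp add: Aut_def \<phi>_eq)
    have "[:a:] * ?w = lfac a * rfac a * ?w" "[:c:] * ?w = lfac c * rfac c * ?w"
      using *[of A A] unfolding endo_basis br AA' endo_comb_lam comb_lam_eq_iff by simp_all
    then have ac: "a = 0 \<or> a = 1" "c = 0 \<or> c = 1"
      using virasoro_ne_0 by (metis bracket_idempotent mult_right_cancel)+
    have "[:b:] * ?w = lfac b * rfac b * ?w" "[:d:] * ?w = lfac d * rfac d * ?w"
      using *[of B B] unfolding endo_basis br BB' endo_comb_lam comb_lam_eq_iff by simp_all
    then have bd: "b = 0 \<or> b = 1" "d = 0 \<or> d = 1"
      using virasoro_ne_0 by (metis bracket_idempotent mult_right_cancel)+
    have "lfac a * rfac b * ?w = 0" "lfac c * rfac d * ?w = 0"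
      using *[of A B] unfolding endo_basis br AB' endo_comb_lam comb_lam_eq_iff by simp_all
    then have ab: "a = 0 \<or> b = 0" "c = 0 \<or> d = 0"
      using virasoro_ne_0 by (metis mult_eq_0_iff lfac_eq_0_iff rfac_eq_0_iff)+
    have "inj (endo a b c d)"
      using \<phi> by (simp add: Aut_def \<phi>_eq bij_is_inj)
    then have "endo a b c d (comb 1 0) \<noteq> endo a b c d (comb 0 0)"
      "endo a b c d (comb 0 1) \<noteq> endo a b c d (comb 0 0)"
      by (simp_all only: inj_eq comb_eq_iff) simp_all
    then have "a \<noteq> 0 \<or> c \<noteq> 0" "b \<noteq> 0 \<or> d \<noteq> 0"
      by simp_all
    then show "\<phi> \<in> {endo 1 0 0 1, endo 0 1 1 0}"
      using ac bd ab unfolding \<phi>_eq by auto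
  next
    fix \<phi> assume "\<phi> \<in> {endo 1 0 0 1, endo 0 1 1 0}"
    moreover have "bij (endo 1 0 0 1)" "bij (endo 0 1 1 0)"
      by (simp add: endo_id, rule o_bij[of "endo 0 1 1 0"]) (simp_all add: endo_comp endo_id)
    ultimately show "\<phi> \<in> carrier (Aut smul bracket)"
      by (auto simp: endo_in_Aut_iff AA' AB' BA' BB' endo_basis br endo_comb_lam
          simp del: comb_lam_0 mult_pCons_left simp flip: one_pCons)
  qed
  show "lie_conformal_algebra smul bracket"
    by (rule lie_conformal_algebra_axioms)
  show "group (integer_mod_group 2)"
    by simp
  define h where "h = (\<lambda>n::int. if n = 0 then endo 1 0 0 1 else endo 0 1 1 0)"
  have Z2: "carrier (integer_mod_group 2) = {0, 1}"
    by (auto simp: carrier_integer_mod_group)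
  show "h ` carrier (integer_mod_group 2) = carrier (Aut smul bracket)"
    by (auto simp: Z2 Aut h_def)
  show "inj_on h (carrier (integer_mod_group 2))"
    by (simp add: Z2 h_def)
  show "h (x \<otimes>\<^bsub>integer_mod_group 2\<^esub> y) = h x \<circ> h y"
    if "x \<in> carrier (integer_mod_group 2)" "y \<in> carrier (integer_mod_group 2)" for x y
    using that unfolding Z2 by (auto simp: integer_mod_group_def h_def endo_comp)
qed


section \<open>The decomposable, nilpotent and solvable algebras\<close>

text \<open>
  Here $A$ is central, and the $A$-component of $[(rA+sB)_\lambda(rA+sB)]$ vanishes while that of
  the image of $[B_\lambda B]$ is $(2\lambda+\partial)r$.  So $r=0$.
\<close>

lemma (in rank_two_ideal) Aut_iso_C_units:
  assumes f: "f = 0" and Q: "Q = 0" and g: "g = 2 * lam + del"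
  shows "Aut smul bracket \<cong> C_units"
proof (rule Aut_iso_of_parametrization)
  show "lie_conformal_algebra smul bracket"
    by (rule lie_conformal_algebra_axioms)
  show "group C_units"
    by (rule group_C_units)
  define h where "h = (\<lambda>k. endo [:k:] 0 0 1)"
  show "h ` carrier C_units = carrier (Aut smul bracket)"
  proof (intro equalityI subsetI)
    fix \<phi> assume \<phi>: "\<phi> \<in> carrier (Aut smul bracket)"
    then obtain a r c b where \<phi>_eq: "\<phi> = endo a r c b" by (rule AutE)
    have c: "c = 0"
      using Aut_bracket_eqs(1)[of a r c b] \<phi> virasoro_ne_0 unfolding \<phi>_eq g mult_eq_0_iff by simp
    obtain k s where ks: "k \<noteq> 0" "a = [:k:]" "b = [:s:]" "g = 0 \<or> s = 1"
      "\<And>d. poly r d * eval2 g 0 d = 0"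
      using \<phi> unfolding \<phi>_eq c triangular_in_Aut_iff by (auto simp: f Q)
    have "[:0, 1:] * r = 0"
      using ks(5) unfolding poly_all_0_iff_0[symmetric] by (simp add: g mult.commute)
    then have "r = 0"
      by (simp del: mult_pCons_left)
    moreover have "s = 1"
      using ks(4) virasoro_ne_0 unfolding g by blast
    ultimately show "\<phi> \<in> h ` carrier C_units"
      using ks by (auto simp: \<phi>_eq c h_def C_units_def)
  next
    fix \<phi> assume "\<phi> \<in> h ` carrier C_units"
    then show "\<phi> \<in> carrier (Aut smul bracket)"
      by (auto simp: h_def C_units_def triangular_in_Aut_iff f Q)
  qed
  show "inj_on h (carrier C_units)"
    by (simp add: inj_on_def h_def)
  show "h (x \<otimes>\<^bsub>C_units\<^esub> y) = h x \<circ> h y" for x y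
    by (simp add: C_units_def h_def endo_comp)
qed

text \<open>
  With $A\mapsto s^2A$ and $B\mapsto rA+sB$, composition reads
  $(s,r)(s',r')=(ss',\,s^2r'+s'r)$.  In terms of $n=r/s$ this is $(s,n)(s',n')=(ss',\,n+sn')$.
\<close>

lemma (in rank_two_ideal) Aut_iso_nil:
  assumes f: "f = 0" and g: "g = 0" and Q: "Q \<noteq> 0"
  shows "Aut smul bracket \<cong> C_units_semidirect (smult :: complex \<Rightarrow> complex poly \<Rightarrow> complex poly)"
proof (rule Aut_iso_of_parametrization)
  let ?G = "C_units_semidirect (smult :: complex \<Rightarrow> complex poly \<Rightarrow> complex poly)"
  show "lie_conformal_algebra smul bracket"
    by (rule lie_conformal_algebra_axioms)
  show "group ?G"
    by (rule group_C_units_semidirect) (simp_all add: smult_add_right)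
  have carrier: "carrier ?G = {(s, n). s \<noteq> 0}"
    by (auto simp: C_units_semidirect_def semidirect_product_def C_units_def additive_group_def)
  define h where "h = (\<lambda>(s, n). endo [:s * s:] (smult s n) 0 [:s:])"
  show "h ` carrier ?G = carrier (Aut smul bracket)"
  proof (intro equalityI subsetI)
    fix \<phi> assume \<phi>: "\<phi> \<in> carrier (Aut smul bracket)"
    then obtain a r c b where \<phi>_eq: "\<phi> = endo a r c b" by (rule AutE)
    have c: "c = 0"
      using Aut_bracket_eqs(2)[of a r c b] \<phi> Q unfolding \<phi>_eq f by simp
    obtain k s where ks: "k \<noteq> 0" "s \<noteq> 0" "a = [:k:]" "b = [:s:]"
      "\<And>l d. k * eval2 Q l d = s * s * eval2 Q l d"
      using \<phi> unfolding \<phi>_eq c triangular_in_Aut_iff by (auto simp: f g)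
    obtain l d where "eval2 Q l d \<noteq> 0"
      using Q by (auto simp: eval2_eq_iff)
    then have "k = s * s"
      using ks(5)[of l d] by simp
    then have "\<phi> = h (s, smult (inverse s) r)"
      using ks by (simp add: \<phi>_eq c h_def)
    then show "\<phi> \<in> h ` carrier ?G"
      using ks(2) by (auto simp: carrier)
  next
    fix \<phi> assume "\<phi> \<in> h ` carrier ?G"
    then show "\<phi> \<in> carrier (Aut smul bracket)"
      by (auto simp: h_def carrier triangular_in_Aut_iff f g)
  qed
  show "inj_on h (carrier ?G)"
    by (auto simp: inj_on_def h_def carrier) (metis smult_smult left_inverse smult_1_left)
  show "h (x \<otimes>\<^bsub>?G\<^esub> y) = h x \<circ> h y" for x y
    by (cases x, cases y) (simp add: C_units_semidirect_def semidirect_product_def C_units_def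
        additive_group_def h_def endo_comp smult_add_right algebra_simps)
qed

text \<open>
  The equation for $r$ is $r(\lambda+\partial)\,a(\lambda)=r(-\lambda)\,a(-\lambda-\partial)$.
  Specialising $\lambda$ to a number $z$ with $a(z)\neq 0$ exhibits $r$ as a multiple of $a(-x)$.
\<close>

lemma (in rank_two_ideal) Aut_iso_sol:
  assumes f: "f = in_lambda a" and g: "g = 0" and Q: "Q = 0" and a: "a \<noteq> 0"
  shows "Aut smul bracket \<cong> C_units_semidirect ((*) :: complex \<Rightarrow> complex \<Rightarrow> complex)"
proof (rule Aut_iso_C_units_semidirect)
  define a' where "a' = a \<circ>\<^sub>p [:0, - 1:]"
  have a'_poly: "poly a' x = poly a (- x)" for x
    by (simp add: a'_def poly_pcompose)
  obtain z where "poly a z \<noteq> 0"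
    using a poly_all_0_iff_0[of a] by blast
  then have z: "poly a' (- z) \<noteq> 0"
    by (simp add: a'_poly)
  have f_ne: "f \<noteq> 0"
    using \<open>poly a z \<noteq> 0\<close> by (metis f eval2_in_lambda eval2_simps(1))
  define \<rho> where "\<rho> = (\<lambda>t. smult t a')"
  show "carrier (Aut smul bracket) = {endo [:k:] (\<rho> v) 0 1 | k v. k \<noteq> 0}"
  proof (intro equalityI subsetI)
    fix \<phi> assume \<phi>: "\<phi> \<in> carrier (Aut smul bracket)"
    then obtain p r c b where \<phi>_eq: "\<phi> = endo p r c b" by (rule AutE)
    have c: "c = 0"
      using Aut_bracket_eqs(3)[of p r c b] \<phi> f_ne unfolding \<phi>_eq g by simp
    obtain k where k: "k \<noteq> 0" "p = [:k:]" "b = 1"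
      and "\<And>l d. poly r (l + d) * eval2 f l d = poly r (- l) * eval2 f (- l - d) d"
      using \<phi> f_ne unfolding \<phi>_eq c triangular_in_Aut_iff by (auto simp: g Q)
    from this(4)[of z] have eq: "poly r x * poly a' (- z) = poly r (- z) * poly a' x" for x
      by (simp add: f a'_poly) (metis add_diff_cancel_left' minus_diff_eq add.commute diff_add_cancel minus_diff_commute)
    have "r = \<rho> (poly r (- z) / poly a' (- z))"
      unfolding poly_eq_poly_eq_iff[symmetric] using eq z by (auto simp: \<rho>_def field_simps)
    then obtain t where "r = \<rho> t" ..
    then show "\<phi> \<in> {endo [:k:] (\<rho> v) 0 1 | k v. k \<noteq> 0}"
      using k unfolding \<phi>_eq c by auto
  next
    fix \<phi> assume "\<phi> \<in> {endo [:k:] (\<rho> v) 0 1 | k v. k \<noteq> 0}"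
    then show "\<phi> \<in> carrier (Aut smul bracket)"
      by (auto simp: triangular_in_Aut_iff g Q f \<rho>_def a'_poly)
  qed
  show "inj \<rho>"
  proof (rule injI)
    fix u v assume "\<rho> u = \<rho> v"
    then have "poly (\<rho> u) (- z) = poly (\<rho> v) (- z)" by simp
    then show "u = v" using z by (simp add: \<rho>_def)
  qed
  show "\<rho> (u + v) = \<rho> u + \<rho> v" for u v
    by (simp add: \<rho>_def smult_add_left)
  show "\<rho> (k * v) = smult k (\<rho> v)" for k v
    by (simp add: \<rho>_def)
qed


section \<open>Coboundaries of the Virasoro part\<close>

text \<open>
  Let $Q=0$, $x=\lambda+\partial$, $y=-\lambda$ and $e=1-c$.  This is the coefficient of $A$ in
  $[(B+rA)_\lambda(B+rA)]-(2\lambda+\partial)(B+rA)$, that is, the coboundary of the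
  cochain $B\mapsto rA$.
\<close>

definition obstruction :: "complex \<Rightarrow> complex \<Rightarrow> complex poly \<Rightarrow> complex \<Rightarrow> complex \<Rightarrow> complex" where
  "obstruction e \<delta> r x y = poly r x * (x + e * y + \<delta>) - poly r y * (y + e * x + \<delta>)
     - (x - y) * poly r (x + y)"

lemma obstruction_cubic:
  "obstruction e 0 [:r0, r1, r2, r3:] x y
    = (x - y) * ((e - 1) * r2 * (x * y) + (e - 2) * r3 * (x * y * (x + y)) - e * r0)"
  unfolding obstruction_def by (simp, algebra)

text \<open>
  Differentiate twice with respect to $y$ at $y=0$.  Up to terms linear in $x$ the result is
  $2r'-xr''$, whose coefficient at $x^{n-1}$ is $-n(n-3)$ times that of $r$ at $x^n$.
\<close>

lemma degree_le_3_of_obstruction: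
  assumes "\<And>x. \<exists>P0 P1 G. \<forall>y. obstruction e 0 r x y
    = P0 + P1 * y + (u + v * x) * y ^ 2 + y ^ 3 * poly G y"
  shows "\<exists>r0 r1 r2 r3. r = [:r0, r1, r2, r3:]"
proof -
  define r' r'' where "r' = pderiv r" and "r'' = pderiv r'"
  have second_deriv: "x * poly r'' x - 2 * poly r' x
      = - (2 * u + 2 * poly r' 0) - (2 * v + e * poly r'' 0) * x" for x
  proof -
    obtain P0 P1 G where eq: "\<And>y. obstruction e 0 r x y
        = P0 + P1 * y + (u + v * x) * y ^ 2 + y ^ 3 * poly G y"
      using assms[of x] by blast
    have "smult (poly r x) [:x, e:] - r * [:e * x, 1:] - [:x, - 1:] * (r \<circ>\<^sub>p [:x, 1:])
        = [:P0, P1, u + v * x:] + [:0, 0, 0, 1:] * G" (is "?F = ?H")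
    proof (rule poly_eqI_by_values)
      fix y
      show "poly ?F y = poly ?H y"
        using eq[of y] by (simp add: obstruction_def poly_pcompose power2_eq_square
            power3_eq_cube algebra_simps)
    qed
    then have "poly (pderiv (pderiv ?F)) 0 = poly (pderiv (pderiv ?H)) 0"
      by simp
    moreover have "poly (pderiv (pderiv ?F)) 0
        = - (2 * poly r' 0 + e * x * poly r'' 0) - (x * poly r'' x - 2 * poly r' x)"
      by (simp add: pderiv_mult pderiv_diff pderiv_add pderiv_minus pderiv_smult pderiv_pCons
          pderiv_pcompose poly_pcompose r'_def r''_def del: mult_pCons_left mult_pCons_right)
    moreover have "poly (pderiv (pderiv ?H)) 0 = 2 * (u + v * x)"
      by (simp add: pderiv_mult pderiv_add pderiv_pCons del: mult_pCons_left mult_pCons_right)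
    ultimately have "- (2 * poly r' 0 + e * x * poly r'' 0) - (x * poly r'' x - 2 * poly r' x)
        = 2 * (u + v * x)"
      by (simp only:)
    then show ?thesis
      by algebra
  qed
  have "[:0, 1:] * r'' - smult 2 r' = [:- (2 * u + 2 * poly r' 0), - (2 * v + e * poly r'' 0):]"
    by (rule poly_eqI_by_values) (use second_deriv in \<open>simp add: algebra_simps\<close>)
  then have "coeff ([:0, 1:] * r'' - smult 2 r') (Suc (Suc n)) = 0" for n
    by simp
  then have "of_nat (n + 3) * of_nat n * coeff r (n + 3) = 0" for n
    by (simp add: coeff_pderiv r'_def r''_def algebra_simps numeral_3_eq_3)
  from this[of "Suc _"] have high: "coeff r (Suc n + 3) = 0" for n
    by (simp del: of_nat_Suc of_nat_add)
  have "r = [:coeff r 0, coeff r 1, coeff r 2, coeff r 3:]"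
  proof (rule poly_eqI)
    fix n
    have "n = 0 \<or> n = 1 \<or> n = 2 \<or> n = 3 \<or> (\<exists>m. n = Suc m + 3)"
      by presburger
    then consider "n = 0" | "n = 1" | "n = 2" | "n = 3" | m where "n = Suc m + 3"
      by blast
    then show "coeff r n = coeff [:coeff r 0, coeff r 1, coeff r 2, coeff r 3:] n"
      by cases (use high in \<open>simp_all add: numeral_eq_Suc\<close>)
  qed
  then show ?thesis by blast
qed

lemma obstruction_eq_0_iff:
  "(\<forall>x y. obstruction e 0 r x y = 0) \<longleftrightarrow>
    (\<exists>r0 r1 r2 r3. r = [:r0, r1, r2, r3:] \<and> (e = 0 \<or> r0 = 0) \<and> (e = 1 \<or> r2 = 0) \<and> (e = 2 \<or> r3 = 0))"
proof
  assume obs: "\<forall>x y. obstruction e 0 r x y = 0"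
  then have "\<exists>P0 P1 G. \<forall>y. obstruction e 0 r x y = P0 + P1 * y + (0 + 0 * x) * y ^ 2 + y ^ 3 * poly G y" for x
    by (auto intro!: exI[of _ 0])
  then obtain r0 r1 r2 r3 where r: "r = [:r0, r1, r2, r3:]"
    using degree_le_3_of_obstruction by blast
  have "(x - y) * ((e - 1) * r2 * (x * y) + (e - 2) * r3 * (x * y * (x + y)) - e * r0) = 0" for x y
    using obs unfolding r obstruction_cubic by blast
  note vals = this[of 1 0] this[of 1 "- 1"] this[of 1 2]
  have e0: "e * r0 = 0" using vals(1) by simp
  moreover have e2: "(e - 1) * r2 = 0" using vals(2) e0 by algebra
  moreover have "(e - 2) * r3 = 0" using vals(3) e0 e2 by algebra
  ultimately have "e = 0 \<or> r0 = 0" "e = 1 \<or> r2 = 0" "e = 2 \<or> r3 = 0"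
    by auto
  then show "\<exists>r0 r1 r2 r3. r = [:r0, r1, r2, r3:] \<and> (e = 0 \<or> r0 = 0) \<and> (e = 1 \<or> r2 = 0) \<and> (e = 2 \<or> r3 = 0)"
    using r by blast
next
  assume "\<exists>r0 r1 r2 r3. r = [:r0, r1, r2, r3:] \<and> (e = 0 \<or> r0 = 0) \<and> (e = 1 \<or> r2 = 0) \<and> (e = 2 \<or> r3 = 0)"
  then show "\<forall>x y. obstruction e 0 r x y = 0"
    by (elim exE conjE) (simp only: obstruction_cubic, auto)
qed

text \<open>
  For $\delta\neq 0$ the equation at $y=0$ already determines $r$ from $r(0)$.
\<close>

lemma obstruction_kernel_shifted:
  assumes "\<delta> \<noteq> 0"
  shows "(\<forall>x y. obstruction e \<delta> r x y = 0) \<longleftrightarrow> r \<in> range (\<lambda>t. smult t [:\<delta>, e:])"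
proof
  assume obs: "\<forall>x y. obstruction e \<delta> r x y = 0"
  have "r = smult (poly r 0 / \<delta>) [:\<delta>, e:]"
  proof (rule poly_eqI_by_values)
    fix x
    have "obstruction e \<delta> r x 0 = 0"
      using obs by blast
    then show "poly r x = poly (smult (poly r 0 / \<delta>) [:\<delta>, e:]) x"
      using assms by (simp add: obstruction_def field_simps)
  qed
  then show "r \<in> range (\<lambda>t. smult t [:\<delta>, e:])"
    by blast
next
  assume "r \<in> range (\<lambda>t. smult t [:\<delta>, e:])"
  then show "\<forall>x y. obstruction e \<delta> r x y = 0"
    by (auto simp: obstruction_def algebra_simps)
qed

text \<open>
  In every case the coefficient of $y^2$ in $Q(-y,x+y)$ is at most linear in $x$, so that $r$ is a
  cubic.  Cancelling $x-y$ and evaluating at a few points with $x\neq y$ then gives linear equations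
  for the coefficients of $r$ and the products $\kappa\beta$, $\kappa\gamma$, which force these products
  to vanish.
\<close>

lemma admissible_Q_not_obstruction:
  assumes adm: "admissible_Q c 0 Q" and "Q \<noteq> 0"
    and eq: "\<And>x y. \<kappa> * eval2 Q (- y) (x + y) = obstruction (1 - c) 0 r x y"
  shows "\<kappa> = 0"
proof -
  have cubic: "\<exists>r0 r1 r2 r3. r = [:r0, r1, r2, r3:]"
    if "\<And>x y. \<kappa> * eval2 Q (- y) (x + y) = P0 x + P1 x * y + (u + v * x) * y ^ 2 + y ^ 3 * poly (G x) y"
    for P0 P1 u v G
    using that unfolding eq by (intro degree_le_3_of_obstruction) blast
  consider "c = 1" | "c = 0" | "c = -1" | "c = -4" | "c = -6"
    using adm \<open>Q \<noteq> 0\<close> unfolding admissible_Q_def by blast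
  then show ?thesis
  proof cases
    case 1
    then obtain \<beta> where Q: "Q = const \<beta> * (2 * lam + del)"
      using adm unfolding admissible_Q_def by blast
    \<comment> \<open>$2\lambda+\partial=x-y$, $\lambda^2+\lambda\partial=-xy$ and $\partial=x+y$\<close>
    have Q_xy: "eval2 Q (- y) (x + y) = \<beta> * (x - y)" for x y
      by (simp add: Q algebra_simps)
    obtain r0 r1 r2 r3 where r: "r = [:r0, r1, r2, r3:]"
      using cubic[of "\<lambda>x. \<kappa> * \<beta> * x" "\<lambda>x. - \<kappa> * \<beta>" 0 0 "\<lambda>x. 0"] unfolding Q_xy
      by (auto simp: algebra_simps)
    have "\<kappa> * \<beta> = 0"
      using eq[of 1 0] unfolding r obstruction_cubic Q_xy by (simp add: 1)
    then show ?thesis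
      using \<open>Q \<noteq> 0\<close> by (auto simp: Q)
  next
    case 2
    then obtain \<beta> \<gamma> where Q: "Q = const \<beta> * (2 * lam + del) * (lam ^ 2 + lam * del)
        + const \<gamma> * (2 * lam + del) * del"
      using adm unfolding admissible_Q_def by blast
    have Q_xy: "eval2 Q (- y) (x + y) = (x - y) * (\<gamma> * (x + y) - \<beta> * x * y)" for x y
      by (simp add: Q) algebra
    obtain r0 r1 r2 r3 where r: "r = [:r0, r1, r2, r3:]"
      using cubic[of "\<lambda>x. \<kappa> * \<gamma> * x ^ 2" "\<lambda>x. - \<kappa> * \<beta> * x ^ 2" "- \<kappa> * \<gamma>" "\<kappa> * \<beta>" "\<lambda>x. 0"]
      unfolding Q_xy by (auto simp: algebra_simps power2_eq_square)
    note eqs = eq[of 1 0, unfolded r obstruction_cubic Q_xy 2, simplified]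
      eq[of 2 0, unfolded r obstruction_cubic Q_xy 2, simplified]
      eq[of 1 "- 1", unfolded r obstruction_cubic Q_xy 2, simplified]
    have "2 * (\<kappa> * \<gamma>) = \<kappa> * \<gamma>"
      using eqs(1,2) by (metis neg_equal_iff_equal mult.commute)
    then have "\<kappa> * \<gamma> = 0"
      by simp
    moreover have "\<kappa> * \<beta> = 0"
      using eqs(1,3) \<open>\<kappa> * \<gamma> = 0\<close> by auto
    ultimately show ?thesis
      using \<open>Q \<noteq> 0\<close> by (auto simp: Q)
  next
    case 3
    then obtain \<beta> \<gamma> where Q: "Q = const \<beta> * (2 * lam + del) * del ^ 2
        + const \<gamma> * (2 * lam + del) * (lam ^ 2 + lam * del) * del"
      using adm unfolding admissible_Q_def by blast
    have Q_xy: "eval2 Q (- y) (x + y) = (x - y) * (\<beta> * (x + y)^2 - \<gamma> * x * y * (x + y))" for x y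
      by (simp add: Q) algebra
    obtain r0 r1 r2 r3 where r: "r = [:r0, r1, r2, r3:]"
      using cubic[of "\<lambda>x. \<kappa> * \<beta> * x ^ 3" "\<lambda>x. \<kappa> * (\<beta> * x ^ 2 - \<gamma> * x ^ 3)" 0 "- \<kappa> * \<beta>"
          "\<lambda>x. [:\<kappa> * (\<gamma> * x - \<beta>):]"]
      unfolding Q_xy by (auto simp: algebra_simps power2_eq_square power3_eq_cube)
    note eqs = eq[of 1 0, unfolded r obstruction_cubic Q_xy 3, simplified]
      eq[of 2 0, unfolded r obstruction_cubic Q_xy 3, simplified]
      eq[of 1 "- 1", unfolded r obstruction_cubic Q_xy 3, simplified]
      eq[of 2 1, unfolded r obstruction_cubic Q_xy 3, simplified]
    have "\<kappa> * \<beta> = 0"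
      using eqs by algebra
    moreover have "\<kappa> * \<gamma> = 0"
      using eqs by algebra
    ultimately show ?thesis
      using \<open>Q \<noteq> 0\<close> by (auto simp: Q)
  next
    case 4
    then obtain \<beta> where Q: "Q = const \<beta> * (2 * lam + del) * (lam ^ 2 + lam * del) ^ 3"
      using adm unfolding admissible_Q_def by blast
    have Q_xy: "eval2 Q (- y) (x + y) = (x - y) * (- \<beta> * (x * y) ^ 3)" for x y
      by (simp add: Q) algebra
    obtain r0 r1 r2 r3 where r: "r = [:r0, r1, r2, r3:]"
      using cubic[of "\<lambda>x. 0" "\<lambda>x. 0" 0 0 "\<lambda>x. [:- \<kappa> * \<beta> * x ^ 4, \<kappa> * \<beta> * x ^ 3:]"]
      unfolding Q_xy by (auto simp: algebra_simps power3_eq_cube power4_eq_xxxx)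
    note eqs = eq[of 1 0, unfolded r obstruction_cubic Q_xy 4, simplified]
      eq[of 1 "- 1", unfolded r obstruction_cubic Q_xy 4, simplified]
      eq[of 2 "- 2", unfolded r obstruction_cubic Q_xy 4, simplified]
    have "\<kappa> * \<beta> = 0"
      using eqs by algebra
    then show ?thesis
      using \<open>Q \<noteq> 0\<close> by (auto simp: Q)
  next
    case 5
    then obtain \<beta> where Q: "Q = const \<beta> * (2 * lam + del)
        * (11 * (lam ^ 2 + lam * del) ^ 4 + 2 * (lam ^ 2 + lam * del) ^ 3 * del ^ 2)"
      using adm unfolding admissible_Q_def by blast
    have Q_xy: "eval2 Q (- y) (x + y)
        = (x - y) * (\<beta> * (x * y) ^ 3 * (11 * x * y - 2 * (x + y) ^ 2))" for x y
      by (simp add: Q) algebra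
    \<comment> \<open>$(x-y)\,(11xy-2(x+y)^2)=-2x^3+9x^2y-9xy^2+2y^3$\<close>
    have Q_tail: "\<kappa> * eval2 Q (- y) (x + y) = 0 + 0 * y + (0 + 0 * x) * y ^ 2
        + y ^ 3 * poly (smult (\<kappa> * \<beta> * x ^ 3) [:- 2 * x ^ 3, 9 * x ^ 2, - 9 * x, 2:]) y" for x y
      unfolding Q_xy by (simp, algebra)
    obtain r0 r1 r2 r3 where r: "r = [:r0, r1, r2, r3:]"
      using cubic[OF Q_tail] by blast
    note eqs = eq[of 1 0, unfolded r obstruction_cubic Q_xy 5, simplified]
      eq[of 1 "- 1", unfolded r obstruction_cubic Q_xy 5, simplified]
      eq[of 2 "- 2", unfolded r obstruction_cubic Q_xy 5, simplified]
    have "\<kappa> * \<beta> = 0"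
      using eqs by algebra
    then show ?thesis
      using \<open>Q \<noteq> 0\<close> by (auto simp: Q)
  qed
qed


section \<open>The algebras whose second generator is of Virasoro type\<close>

locale rank_two_virasoro = rank_two_ideal +
  fixes c \<delta>
  assumes f_eq: "f = const c * lam + const \<delta> + del" and g_eq: "g = 2 * lam + del"
begin

text \<open>
  For an automorphism $\phi$, the $B$-component of $[\phi(A)_\lambda\phi(A)]=0$ shows that the matrix
  is triangular, and that of $[\phi(B)_\lambda\phi(B)]=\phi([B_\lambda B])$ gives $s^2=s$.
\<close>

lemma carrier_Aut:
  "carrier (Aut smul bracket) = {endo [:k:] r 0 1 | k r. k \<noteq> 0 \<and>
    (\<forall>x y. (k - 1) * eval2 Q (- y) (x + y) = obstruction (1 - c) \<delta> r x y)}" (is "_ = ?S")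
proof -
  have triangular: "endo [:k:] r 0 1 \<in> carrier (Aut smul bracket) \<longleftrightarrow> k \<noteq> 0 \<and>
      (\<forall>x y. (k - 1) * eval2 Q (- y) (x + y) = obstruction (1 - c) \<delta> r x y)" for k r
  proof -
    let ?E = "\<lambda>l d. k * eval2 Q l d + poly r d * eval2 g l d = eval2 Q l d
        + (poly r (l + d) * eval2 f l d - poly r (- l) * eval2 f (- l - d) d)"
    have move: "k * q + u = q + v \<longleftrightarrow> (k - 1) * q = v - u" for q u v
      by (auto simp: algebra_simps)
    have "endo [:k:] r 0 1 \<in> carrier (Aut smul bracket) \<longleftrightarrow> k \<noteq> 0 \<and> (\<forall>l d. ?E l d)"
      unfolding triangular_in_Aut_iff by (auto simp: eq_commute[of 1])
    also have "(\<forall>l d. ?E l d) \<longleftrightarrow> (\<forall>x y. ?E (- y) (x + y))"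
    proof (intro iffI allI)
      fix l d assume "\<forall>x y. ?E (- y) (x + y)"
      then have "?E (- (- l)) ((l + d) + - l)" by blast
      then show "?E l d" by simp
    qed blast
    also have "\<dots> \<longleftrightarrow> (\<forall>x y. (k - 1) * eval2 Q (- y) (x + y) = obstruction (1 - c) \<delta> r x y)"
    proof (intro all_cong1)
      fix x y
      have "poly r (x + y) * eval2 g (- y) (x + y) = (x - y) * poly r (x + y)"
        by (simp add: g_eq)
      moreover have "poly r (- y + (x + y)) * eval2 f (- y) (x + y)
          - poly r (- (- y)) * eval2 f (- (- y) - (x + y)) (x + y)
          = poly r x * (x + (1 - c) * y + \<delta>) - poly r y * (y + (1 - c) * x + \<delta>)"
        by (simp add: f_eq algebra_simps)
      ultimately show "?E (- y) (x + y) \<longleftrightarrow>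
          (k - 1) * eval2 Q (- y) (x + y) = obstruction (1 - c) \<delta> r x y"
        by (simp only: move obstruction_def)
    qed
    finally show ?thesis .
  qed
  show ?thesis
  proof (intro equalityI subsetI)
    fix \<phi> assume \<phi>: "\<phi> \<in> carrier (Aut smul bracket)"
    then obtain a r c' b where \<phi>_eq: "\<phi> = endo a r c' b" by (rule AutE)
    have c': "c' = 0"
      using Aut_bracket_eqs(1)[of a r c' b] \<phi> virasoro_ne_0 unfolding \<phi>_eq g_eq mult_eq_0_iff by simp
    obtain k s where ks: "a = [:k:]" "b = [:s:]" "g = 0 \<or> s = 1"
      using \<phi> unfolding \<phi>_eq c' triangular_in_Aut_iff by blast
    have "s = 1"
      using ks(3) virasoro_ne_0 unfolding g_eq by blast
    then have "\<phi> = endo [:k:] r 0 1"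
      using ks by (simp add: \<phi>_eq c')
    then show "\<phi> \<in> ?S"
      using \<phi> triangular by blast
  next
    fix \<phi> assume "\<phi> \<in> ?S"
    then show "\<phi> \<in> carrier (Aut smul bracket)"
      using triangular by blast
  qed
qed

lemma Aut_iso_semidirect:
  fixes \<rho> :: "'v::ab_group_add \<Rightarrow> complex poly"
  assumes "Q = 0" and kernel: "\<And>r. (\<forall>x y. obstruction (1 - c) \<delta> r x y = 0) \<longleftrightarrow> r \<in> range \<rho>"
    and "inj \<rho>" "\<And>u v. \<rho> (u + v) = \<rho> u + \<rho> v" "\<And>k v. \<rho> (sc k v) = smult k (\<rho> v)"
  shows "Aut smul bracket \<cong> C_units_semidirect sc"
proof (rule Aut_iso_C_units_semidirect)
  show "carrier (Aut smul bracket) = {endo [:k:] (\<rho> v) 0 1 | k v. k \<noteq> 0}"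
    unfolding carrier_Aut using kernel by (auto simp: \<open>Q = 0\<close> eq_commute[of 0])
qed (use assms in auto)

lemma Aut_iso_additive:
  fixes \<rho> :: "'v::ab_group_add \<Rightarrow> complex poly"
  assumes "admissible_Q c \<delta> Q" "Q \<noteq> 0"
    and kernel: "\<And>r. (\<forall>x y. obstruction (1 - c) \<delta> r x y = 0) \<longleftrightarrow> r \<in> range \<rho>"
    and "inj \<rho>" "\<And>u v. \<rho> (u + v) = \<rho> u + \<rho> v"
  shows "Aut smul bracket \<cong> (additive_group :: 'v monoid)"
proof (rule Aut_iso_additive_group)
  have "\<delta> = 0"
    using assms(1,2) by (auto simp: admissible_Q_def)
  have "(k \<noteq> 0 \<and> (\<forall>x y. (k - 1) * eval2 Q (- y) (x + y) = obstruction (1 - c) \<delta> r x y))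
      \<longleftrightarrow> k = 1 \<and> r \<in> range \<rho>" (is "_ \<and> ?E \<longleftrightarrow> _") for k r
  proof (cases "k = 1")
    case True
    then show ?thesis
      unfolding kernel[symmetric] by (auto simp: eq_commute[of 0])
  next
    case False
    then have "\<not> ?E"
      using admissible_Q_not_obstruction[of c Q "k - 1" r] assms(1,2) by (auto simp: \<open>\<delta> = 0\<close>)
    then show ?thesis
      using False by blast
  qed
  then show "carrier (Aut smul bracket) = {endo 1 (\<rho> v) 0 1 | v. True}"
    unfolding carrier_Aut by auto
qed (use assms in auto)

lemma Aut_iso_shifted:
  assumes "\<delta> \<noteq> 0" "Q = 0"
  shows "Aut smul bracket \<cong> C_units_semidirect ((*) :: complex \<Rightarrow> complex \<Rightarrow> complex)"
proof (rule Aut_iso_semidirect)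
  show "inj (\<lambda>t. smult t [:\<delta>, 1 - c:])"
    using assms by (auto simp: inj_def)
  show "(\<forall>x y. obstruction (1 - c) \<delta> r x y = 0) \<longleftrightarrow> r \<in> range (\<lambda>t. smult t [:\<delta>, 1 - c:])" for r
    by (rule obstruction_kernel_shifted[OF assms(1)])
qed (simp_all add: assms algebra_simps)

lemma kernel_generic:
  assumes "c \<notin> {1, 0, -1}"
  shows "(\<forall>x y. obstruction (1 - c) 0 r x y = 0) \<longleftrightarrow> r \<in> range (\<lambda>t. [:0, t:])"
proof -
  have "1 - c \<noteq> 0" "1 - c \<noteq> 1" "1 - c \<noteq> 2"
    using assms by (auto simp: diff_eq_eq eq_neg_iff_add_eq_0 add.commute)
  then show ?thesis
    unfolding obstruction_eq_0_iff by auto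
qed

lemma Aut_iso_generic:
  assumes "\<delta> = 0" "c \<notin> {1, 0, -1}"
  shows "Q = 0 \<Longrightarrow> Aut smul bracket \<cong> C_units_semidirect ((*) :: complex \<Rightarrow> complex \<Rightarrow> complex)"
    and "admissible_Q c \<delta> Q \<Longrightarrow> Q \<noteq> 0 \<Longrightarrow> Aut smul bracket \<cong> (additive_group :: complex monoid)"
proof -
  have kernel: "(\<forall>x y. obstruction (1 - c) \<delta> r x y = 0) \<longleftrightarrow> r \<in> range (\<lambda>t. [:0, t:])" for r
    unfolding assms(1) by (rule kernel_generic[OF assms(2)])
  show "Aut smul bracket \<cong> C_units_semidirect ((*) :: complex \<Rightarrow> complex \<Rightarrow> complex)" if "Q = 0"
    by (rule Aut_iso_semidirect[OF that kernel]) (auto simp: inj_def)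
  show "Aut smul bracket \<cong> (additive_group :: complex monoid)" if "admissible_Q c \<delta> Q" "Q \<noteq> 0"
    by (rule Aut_iso_additive[OF that kernel]) (auto simp: inj_def)
qed

text \<open>
  The second generator of the kernel is $1$, $x^2$ or $x^3$, according to $c=1,0,-1$.
\<close>

lemma Aut_iso_special:
  assumes "\<delta> = 0" "c \<in> {1, 0, -1}"
  shows "Q = 0 \<Longrightarrow>
      Aut smul bracket \<cong> C_units_semidirect ((*s) :: complex \<Rightarrow> complex ^ 2 \<Rightarrow> complex ^ 2)"
    and "admissible_Q c \<delta> Q \<Longrightarrow> Q \<noteq> 0 \<Longrightarrow> Aut smul bracket \<cong> (additive_group :: (complex ^ 2) monoid)"
proof -
  define \<rho> :: "complex ^ 2 \<Rightarrow> complex poly" where "\<rho> v =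
    (if c = 1 then [:v$1, v$2:] else if c = 0 then [:0, v$2, v$1:] else [:0, v$2, 0, v$1:])" for v
  have ex_vec: "(\<exists>v :: complex ^ 2. P (v$1) (v$2)) \<longleftrightarrow> (\<exists>a b. P a b)" for P
    by (metis vector_2)
  have kernel: "(\<forall>x y. obstruction (1 - c) \<delta> r x y = 0) \<longleftrightarrow> r \<in> range \<rho>" for r
  proof -
    have "r \<in> range \<rho> \<longleftrightarrow> (\<exists>a b. r = (if c = 1 then [:a, b:] else if c = 0 then [:0, b, a:]
        else [:0, b, 0, a:]))"
      unfolding image_iff \<rho>_def
      using ex_vec[of "\<lambda>a b. r = (if c = 1 then [:a, b:] else if c = 0 then [:0, b, a:]
        else [:0, b, 0, a:])"] by simp
    then show ?thesis
      using assms by (auto simp: obstruction_eq_0_iff)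
  qed
  have inj: "inj \<rho>"
    by (auto simp: inj_def \<rho>_def vec_eq_iff forall_2 split: if_splits)
  have add: "\<rho> (u + v) = \<rho> u + \<rho> v" and sc: "\<rho> (k *s v) = smult k (\<rho> v)" for u v k
    by (simp_all add: \<rho>_def)
  show "Aut smul bracket \<cong> C_units_semidirect ((*s) :: complex \<Rightarrow> complex ^ 2 \<Rightarrow> complex ^ 2)"
    if "Q = 0"
    by (rule Aut_iso_semidirect[OF that kernel inj add sc])
  show "Aut smul bracket \<cong> (additive_group :: (complex ^ 2) monoid)"
    if "admissible_Q c \<delta> Q" "Q \<noteq> 0"
    by (rule Aut_iso_additive[OF that kernel inj add])
qed

end


section \<open>The automorphism groups\<close>

theorem theorem3p3:
  fixes smul :: "complex poly \<Rightarrow> 'r::ab_group_add \<Rightarrow> 'r"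
    and bracket :: "'r \<Rightarrow> 'r \<Rightarrow> 'r poly"
  shows
    "(is_R_c smul bracket \<longrightarrow> Aut smul bracket \<cong> GL2) \<and>
     (is_R_ss smul bracket \<longrightarrow> Aut smul bracket \<cong> integer_mod_group 2) \<and>
     (is_R_cs smul bracket \<longrightarrow> Aut smul bracket \<cong> C_units) \<and>
     (\<forall>Q. skew_symmetric Q \<and> Q \<noteq> 0 \<and> is_R_nil Q smul bracket \<longrightarrow>
        Aut smul bracket \<cong> C_units_semidirect (smult :: complex \<Rightarrow> complex poly \<Rightarrow> complex poly)) \<and>
     (\<forall>a. a \<noteq> 0 \<and> is_R_sol a smul bracket \<longrightarrow>
        Aut smul bracket \<cong> C_units_semidirect ((*) :: complex \<Rightarrow> complex \<Rightarrow> complex)) \<and>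
     (\<forall>c d Q. admissible_Q c d Q \<and> is_R c d Q smul bracket \<longrightarrow>
        (d \<noteq> 0 \<longrightarrow>
           Aut smul bracket \<cong> C_units_semidirect ((*) :: complex \<Rightarrow> complex \<Rightarrow> complex)) \<and>
        (d = 0 \<and> c \<notin> {1, 0, -1} \<and> Q \<noteq> 0 \<longrightarrow>
           Aut smul bracket \<cong> (additive_group :: complex monoid)) \<and>
        (d = 0 \<and> c \<notin> {1, 0, -1} \<and> Q = 0 \<longrightarrow>
           Aut smul bracket \<cong> C_units_semidirect ((*) :: complex \<Rightarrow> complex \<Rightarrow> complex)) \<and>
        (d = 0 \<and> c \<in> {1, 0, -1} \<and> Q \<noteq> 0 \<longrightarrow>
           Aut smul bracket \<cong> (additive_group :: (complex ^ 2) monoid)) \<and>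
        (d = 0 \<and> c \<in> {1, 0, -1} \<and> Q = 0 \<longrightarrow>
           Aut smul bracket \<cong> C_units_semidirect ((*s) :: complex \<Rightarrow> complex ^ 2 \<Rightarrow> complex ^ 2)))"
proof (intro conjI allI impI; (elim conjE)?)
  assume *: "is_R_c smul bracket"
  then obtain A B where "rank_two smul bracket A B"
    by (auto simp: is_R_c_def rank_two_def rank_two_axioms_def)
  then show "Aut smul bracket \<cong> GL2"
    using * by (intro rank_two.Aut_iso_GL2) (auto simp: is_R_c_def)
next
  assume "is_R_ss smul bracket"
  then obtain A B where "rank_two smul bracket A B" and
    "bracket A A = act smul (2 * lam + del) A" "bracket A B = 0"
    "bracket B A = 0" "bracket B B = act smul (2 * lam + del) B"
    unfolding is_R_ss_def rank_two_def rank_two_axioms_def by blast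
  then show "Aut smul bracket \<cong> integer_mod_group 2"
    by (rule rank_two.Aut_iso_Z2)
next
  assume "is_R_cs smul bracket"
  then obtain A B where rank_two: "rank_two smul bracket A B" and
    br: "bracket A A = 0" "bracket A B = 0" "bracket B B = act smul (2 * lam + del) B"
    unfolding is_R_cs_def rank_two_def rank_two_axioms_def by blast
  interpret rank_two smul bracket A B by fact
  have "bracket B A = 0"
    using bracket_skew[of A B 0 0] br by simp
  then have "rank_two_ideal smul bracket A B 0 0 (2 * lam + del)"
    using rank_two br by (simp add: rank_two_ideal_def rank_two_ideal_axioms_def act_basis)
  then show "Aut smul bracket \<cong> C_units"
    by (rule rank_two_ideal.Aut_iso_C_units) simp_all
next
  fix Q assume "is_R_nil Q smul bracket" and Q: "Q \<noteq> 0"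
  then obtain A B where rank_two: "rank_two smul bracket A B" and
    br: "bracket A A = 0" "bracket B A = 0" "bracket B B = act smul Q A"
    unfolding is_R_nil_def rank_two_def rank_two_axioms_def by blast
  interpret rank_two smul bracket A B by fact
  have "rank_two_ideal smul bracket A B 0 Q 0"
    using rank_two br by (simp add: rank_two_ideal_def rank_two_ideal_axioms_def act_basis)
  then show "Aut smul bracket \<cong> C_units_semidirect (smult :: complex \<Rightarrow> complex poly \<Rightarrow> complex poly)"
    by (rule rank_two_ideal.Aut_iso_nil) (simp_all add: Q)
next
  fix a assume "is_R_sol a smul bracket" and a_ne_0: "a \<noteq> 0"
  then obtain A B where rank_two: "rank_two smul bracket A B" and
    br: "bracket A A = 0" "bracket B B = 0" "bracket B A = act smul (in_lambda a) A"
    unfolding is_R_sol_def rank_two_def rank_two_axioms_def by blast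
  interpret rank_two smul bracket A B by fact
  have "rank_two_ideal smul bracket A B (in_lambda a) 0 0"
    using rank_two br by (simp add: rank_two_ideal_def rank_two_ideal_axioms_def act_basis)
  then show "Aut smul bracket \<cong> C_units_semidirect ((*) :: complex \<Rightarrow> complex \<Rightarrow> complex)"
    using a_ne_0 by (intro rank_two_ideal.Aut_iso_sol[OF _ refl refl refl])
next
  fix c d Q assume adm: "admissible_Q c d Q" and "is_R c d Q smul bracket"
  then obtain A B where rank_two: "rank_two smul bracket A B" and
    br: "bracket A A = 0" "bracket B A = act smul (const c * lam + const d + del) A"
      "bracket B B = act smul Q A + act smul (2 * lam + del) B"
    unfolding is_R_def rank_two_def rank_two_axioms_def by blast
  then interpret rank_two_virasoro smul bracket A B "const c * lam + const d + del" Q "2 * lam + del" c d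
    unfolding rank_two_virasoro_def rank_two_ideal_def rank_two_ideal_axioms_def
      rank_two_virasoro_axioms_def by blast
  {
    assume "d \<noteq> 0"
    moreover have "Q = 0"
      using adm \<open>d \<noteq> 0\<close> by (simp add: admissible_Q_def)
    ultimately show "Aut smul bracket \<cong> C_units_semidirect ((*) :: complex \<Rightarrow> complex \<Rightarrow> complex)"
      by (rule Aut_iso_shifted)
  next
    assume "d = 0" "c \<notin> {1, 0, -1}" "Q \<noteq> 0"
    then show "Aut smul bracket \<cong> (additive_group :: complex monoid)"
      using Aut_iso_generic(2) adm by blast
  next
    assume "d = 0" "c \<notin> {1, 0, -1}" "Q = 0"
    then show "Aut smul bracket \<cong> C_units_semidirect ((*) :: complex \<Rightarrow> complex \<Rightarrow> complex)"
      using Aut_iso_generic(1) by blast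
  next
    assume "d = 0" "c \<in> {1, 0, -1}" "Q \<noteq> 0"
    then show "Aut smul bracket \<cong> (additive_group :: (complex ^ 2) monoid)"
      using Aut_iso_special(2) adm by blast
  next
    assume "d = 0" "c \<in> {1, 0, -1}" "Q = 0"
    then show "Aut smul bracket
        \<cong> C_units_semidirect ((*s) :: complex \<Rightarrow> complex ^ 2 \<Rightarrow> complex ^ 2)"
      using Aut_iso_special(1) by blast
  }
qed

end
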